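(* Let $\mu>0$ (mass), $g>0$, $\gamma>0$, $\boldsymbol r_0\in\mathbb{R}^2\setminus\{0\}$, and $$f(\boldsymbol r)=-\gamma\Big(\frac{1}{|\boldsymbol r-\boldsymbol r_0|^n}+\frac{1}{|\boldsymbol r+\boldsymbol r_0|^n}\Big),\qquad \boldsymbol r\in\mathbb{R}^2\setminus\{\boldsymbol r_0,-\boldsymbol r_0\}.$$ Consider the Lagrangian system (a particle sliding without friction under gravity on the surface $z=f(\boldsymbol r)$) with Lagrangian $$L(\boldsymbol r,\dot{\boldsymbol r})=\frac{\mu}{2}\Big(|\dot{\boldsymbol r}|^2+\big(\nabla f(\boldsymbol r),\dot{\boldsymbol r}\big)^2\Big)-\mu g f(\boldsymbol r).$$ For any $\omega>0$, any $n\ge2$ and any $m\in\mathbb{N}$ ($m\ge1$) this system has an $\omega$-periodic solution $\boldsymbol r(t)$ that first coils $m$ times clockwise about the point $\boldsymbol r_0$ and then coils $m$ times counterclockwise about the point $-\boldsymbol r_0$. If $m=1$, the solution $\boldsymbol r(t)$ forms an $8$-like curve in the plane.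
   Context: A solution is a $C^2$ function $\boldsymbol r:\mathbb{R}\to\mathbb{R}^2\setminus\{\pm\boldsymbol r_0\}$ satisfying the Euler–Lagrange equations of $L$; $|\cdot|$ and $(\cdot,\cdot)$ are the Euclidean norm and inner product. Meaning of "coils": the statement is about the homotopy type of the closed curve. Let $\alpha$ be the loop based at $0$ that goes along the straight segment from $0$ towards $\boldsymbol r_0$, goes once clockwise around a small circle centered at $\boldsymbol r_0$, and returns to $0$ along the segment; let $\beta$ be the loop based at $0$ that goes along the straight segment from $0$ towards $-\boldsymbol r_0$, goes once counterclockwise around a small circle centered at $-\boldsymbol r_0$, and returns. That the $\omega$-periodic curve $\boldsymbol r$ first coils $m$ times clockwise about $\boldsymbol r_0$ and then $m$ times counterclockwise about $-\boldsymbol r_0$ means that $\boldsymbol r|_{[0,\omega]}$, as a closed curve, is homotopic through closed curves in $\mathbb{R}^2\setminus\{\pm\boldsymbol r_0\}$ to the concatenation of $m$ copies of $\alpha$ followed by $m$ copies of $\beta$. For $m=1$ this is the homotopy type of a figure-eight curve around the two points, which is the sense of "$8$-like curve". *)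

theory Defs
  imports "HOL-Analysis.Analysis"
begin

definition grad :: "('a::real_inner \<Rightarrow> real) \<Rightarrow> 'a \<Rightarrow> 'a" where
  "grad f x = (THE D. GDERIV f x :> D)"

lemma GDERIV_imp_grad:
  assumes "GDERIV f x :> D"
  shows "grad f x = D"
  unfolding grad_def
proof (rule the_equality)
  fix D' assume "GDERIV f x :> D'"
  with assms have "(\<lambda>h. inner h D') = (\<lambda>h. inner h D)"
    unfolding gderiv_def by (rule has_derivative_unique[rotated])
  then have "\<And>h. inner h D' = inner h D" by metis
  then have "inner (D' - D) (D' - D) = 0" by (simp only: inner_diff_right)
  then show "D' = D" by simp
qed (rule assms)

definition sliding_lagrangian ::
  "real \<Rightarrow> real \<Rightarrow> (real^2 \<Rightarrow> real) \<Rightarrow> real^2 \<Rightarrow> real^2 \<Rightarrow> real" where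
  "sliding_lagrangian \<mu> g f q v =
     \<mu> / 2 * ((norm v)\<^sup>2 + (grad f q \<bullet> v)\<^sup>2) - \<mu> * g * f q"

text \<open>The exponent is real, hence \<open>powr\<close>; the values at the two punctures are irrelevant.\<close>

definition two_wells :: "real \<Rightarrow> real \<Rightarrow> real^2 \<Rightarrow> real^2 \<Rightarrow> real" where
  "two_wells \<gamma> n r0 q =
     - \<gamma> * (1 / norm (q - r0) powr n + 1 / norm (q + r0) powr n)"

text \<open>
  A \<open>C\<^sup>2\<close> curve in the open set \<open>S\<close> along which
  \<open>d/dt (\<partial>L/\<partial>v) = \<partial>L/\<partial>q\<close>. Here \<open>v\<close> and \<open>a\<close> are its velocity and acceleration,
  and \<open>p t\<close> and \<open>F t\<close> are the two partial gradients of \<open>L\<close> at \<open>(r t, v t)\<close>.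
\<close>

definition lagrangian_solution ::
  "'a::euclidean_space set \<Rightarrow> ('a \<Rightarrow> 'a \<Rightarrow> real) \<Rightarrow> (real \<Rightarrow> 'a) \<Rightarrow> bool" where
  "lagrangian_solution S L r \<longleftrightarrow>
     (\<forall>t. r t \<in> S) \<and>
     (\<exists>v a p F.
        (\<forall>t. (r has_vector_derivative v t) (at t)) \<and>
        (\<forall>t. (v has_vector_derivative a t) (at t)) \<and>
        continuous_on UNIV a \<and>
        (\<forall>t. GDERIV (\<lambda>u. L (r t) u) (v t) :> p t) \<and>
        (\<forall>t. GDERIV (\<lambda>q. L q (v t)) (r t) :> F t) \<and>
        (\<forall>t. (p has_vector_derivative F t) (at t)))"

text \<open>Counterclockwise rotation by the angle \<open>\<theta>\<close>.\<close>

definition rot :: "real \<Rightarrow> real^2 \<Rightarrow> real^2" where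
  "rot \<theta> x = vector [cos \<theta> * x $ 1 - sin \<theta> * x $ 2, sin \<theta> * x $ 1 + cos \<theta> * x $ 2]"

text \<open>
  The loop from \<open>0\<close> straight towards \<open>c\<close> up to the circle of radius \<open>\<rho>\<close> about \<open>c\<close>, along this
  circle through the total signed angle \<open>\<theta>\<close>, and back to \<open>0\<close>; meant for \<open>0 < \<rho> < norm c\<close> and
  \<open>\<theta> = \<plusminus>2\<pi>\<close> (negative is clockwise).
\<close>

definition lasso :: "real^2 \<Rightarrow> real \<Rightarrow> real \<Rightarrow> real \<Rightarrow> real^2" where
  "lasso c \<rho> \<theta> =
     (let e = c - (\<rho> / norm c) *\<^sub>R c
      in linepath 0 e +++ ((\<lambda>s. c + rot (\<theta> * s) (e - c)) +++ linepath e 0))"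

text \<open>Concatenation of \<open>m \<ge> 1\<close> copies of a loop; the value at \<open>m = 0\<close> is the constant loop.\<close>

fun loop_copies :: "nat \<Rightarrow> (real \<Rightarrow> 'a::topological_space) \<Rightarrow> real \<Rightarrow> 'a" where
  "loop_copies 0 p = (\<lambda>_. pathstart p)"
| "loop_copies (Suc 0) p = p"
| "loop_copies (Suc (Suc m)) p = p +++ loop_copies (Suc m) p"

text \<open>
  Free homotopy of \<open>r\<close> on \<open>[0, \<omega>]\<close>, reparametrised to \<open>[0, 1]\<close>. Every radius \<open>\<rho> < norm r0\<close> counts
  as small: the homotopy class of the lassos in the twice punctured plane does not depend on it.
\<close>

definition coils :: "nat \<Rightarrow> real^2 \<Rightarrow> real \<Rightarrow> (real \<Rightarrow> real^2) \<Rightarrow> bool" where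
  "coils m r0 \<omega> r \<longleftrightarrow>
     (\<forall>\<rho>. 0 < \<rho> \<and> \<rho> < norm r0 \<longrightarrow>
        homotopic_loops (- {r0, - r0}) (\<lambda>s. r (\<omega> * s))
          (loop_copies m (lasso r0 \<rho> (- 2 * pi)) +++ loop_copies m (lasso (- r0) \<rho> (2 * pi))))"

definition figure_eight :: "real^2 \<Rightarrow> real \<Rightarrow> (real \<Rightarrow> real^2) \<Rightarrow> bool" where
  "figure_eight r0 \<omega> r \<longleftrightarrow>
     (\<forall>\<rho>. 0 < \<rho> \<and> \<rho> < norm r0 \<longrightarrow>
        homotopic_loops (- {r0, - r0}) (\<lambda>s. r (\<omega> * s))
          (lasso r0 \<rho> (- 2 * pi) +++ lasso (- r0) \<rho> (2 * pi)))"

end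

(* The action is minimised over closed polygons q with N vertices in the given homotopy class, the
   velocity and d/dt f(r) being replaced by difference quotients with step h = omega / N.

   No collisions: the action controls the energy of the graph curve (r, f(r)), hence the oscillation
   of f along the polygon, while the potential term bounds min |f|.  So f is bounded along polygons of
   bounded action and these stay uniformly away from the wells.  They stay bounded because the class is
   not null-homotopic: a far away polygon of bounded length lies in a ball avoiding both wells.

   The stationarity condition at a vertex, with Taylor's formula for f, gives the second difference of q
   explicitly and bounds it by h (g + B |v|^2), v being the discrete velocity.  The energy bound turns
   this into a bound on the variation of v, hence on v itself.  The pairs (q, v) therefore satisfy a
   one-step scheme consistent with the equation of motion, and by Arzela-Ascoli a subsequence converges
   uniformly, as h tends to 0, to a solution, which lies in the same homotopy class.  The class is not
   null-homotopic because its winding number about r0 is -m. *)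

theory Submission
  imports Defs "HOL-Complex_Analysis.Great_Picard"
begin

section \<open>Polygons with integer-indexed vertices\<close>

text \<open>Discretising keeps every minimisation finite-dimensional, so no Sobolev space or weak
  limit occurs; the difficulty moves to bounds that do not depend on N. The term (grad f, v)^2 plays
  the part of a strong-force condition: f tends to -infinity at the wells, so a path running into a
  well would have infinite kinetic energy. As f <= 0, the potential part -g f of the action is
  nonnegative, and the kinetic and potential parts are bounded separately. A common bound c for the
  actions comes from sampling one fixed smooth loop, and the resulting bounds on positions, on f and
  on velocities contain N and h only through N h = omega. Vertices at distance \<delta> from the
  wells do not yet prevent an edge from crossing a well. Edges have length at most sqrt(2 h c), so
  on a fine mesh they are no longer than \<delta>/2; then vertexwise limits stay in the homotopy
  class. The mass is a common factor of the Lagrangian and is divided out of the action. The mass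
  matrix that remains is I + G G^T with G = grad f, and it is inverted explicitly.\<close>

lemma norm_diff_le_steps:
  fixes a :: "int \<Rightarrow> 'a::real_normed_vector"
  assumes "i \<le> j" and "\<And>l. i \<le> l \<Longrightarrow> l < j \<Longrightarrow> norm (a (l + 1) - a l) \<le> D"
  shows "norm (a j - a i) \<le> (of_int j - of_int i) * D"
  using assms
proof (induction j rule: int_ge_induct)
  case base
  then show ?case by simp
next
  case (step j)
  have "norm (a (j + 1) - a i) \<le> norm (a (j + 1) - a j) + norm (a j - a i)"
    by (metis add.commute diff_add_cancel add_diff_eq norm_triangle_ineq)
  also have "\<dots> \<le> D + (of_int j - of_int i) * D"
    by (intro add_mono step.IH step.prems) (use step in auto)
  finally show ?case by (simp add: algebra_simps)
qed

text \<open>Indexing by all integers makes a closed polygon a periodic sequence, so that no index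
  has to wrap around. One edge takes one unit of the parameter; the mesh enters only by rescaling
  the argument.\<close>

definition polygon :: "(int \<Rightarrow> 'a::real_normed_vector) \<Rightarrow> real \<Rightarrow> 'a" where
  "polygon a x = a \<lfloor>x\<rfloor> + frac x *\<^sub>R (a (\<lfloor>x\<rfloor> + 1) - a \<lfloor>x\<rfloor>)"

lemma polygon_of_int [simp]: "polygon a (of_int i) = a i"
  by (simp add: polygon_def)

lemma polygon_0 [simp]: "polygon a 0 = a 0"
  by (simp add: polygon_def)

lemma polygon_in_convex:
  assumes "convex C" "\<And>i. a i \<in> C"
  shows "polygon a x \<in> C"
proof -
  have "polygon a x = (1 - frac x) *\<^sub>R a \<lfloor>x\<rfloor> + frac x *\<^sub>R a (\<lfloor>x\<rfloor> + 1)"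
    by (simp add: polygon_def algebra_simps)
  also have "\<dots> \<in> C"
    using frac_lt_1[of x] by (intro convexD assms) (auto simp: less_imp_le)
  finally show ?thesis .
qed

lemma polygon_diff: "polygon a x - polygon b x = polygon (\<lambda>i. a i - b i) x"
  by (simp add: polygon_def algebra_simps)

lemma norm_polygon_diff_le:
  assumes "\<And>i. norm (a i - b i) \<le> e"
  shows "norm (polygon a x - polygon b x) \<le> e"
  using polygon_in_convex[of "cball 0 e" "\<lambda>i. a i - b i" x] assms
  by (simp add: polygon_diff)

lemma polygon_minus_vertex:
  assumes "\<And>i. norm (a (i + 1) - a i) \<le> D"
  shows "norm (polygon a x - a \<lfloor>x\<rfloor>) \<le> frac x * D"
  using assms[of "\<lfloor>x\<rfloor>"] by (simp add: polygon_def mult_left_mono)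

lemma polygon_minus_vertex_le:
  assumes "\<And>i. norm (a (i + 1) - a i) \<le> D"
  shows "norm (polygon a x - a \<lfloor>x\<rfloor>) \<le> D"
proof -
  have "D \<ge> 0" using assms order_trans norm_ge_zero by blast
  then have "frac x * D \<le> 1 * D"
    using frac_lt_1[of x] by (intro mult_right_mono) auto
  then show ?thesis using polygon_minus_vertex[of a D x, OF assms] by simp
qed

lemma polygon_lipschitz:
  assumes "\<And>i. norm (a (i + 1) - a i) \<le> D"
  shows "norm (polygon a y - polygon a x) \<le> D * \<bar>y - x\<bar>"
proof -
  have *: "norm (polygon a y - polygon a x) \<le> D * (y - x)" if "x \<le> y" for x y
  proof (cases "\<lfloor>x\<rfloor> = \<lfloor>y\<rfloor>")
    case True
    then have fr: "frac y - frac x = y - x" by (simp add: frac_def)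
    have "polygon a y - polygon a x = (frac y - frac x) *\<^sub>R (a (\<lfloor>x\<rfloor> + 1) - a \<lfloor>x\<rfloor>)"
      using True by (simp add: polygon_def algebra_simps)
    then show ?thesis
      unfolding fr using that mult_left_mono[OF assms[of "\<lfloor>x\<rfloor>"], of "y - x"]
      by (simp add: mult.commute)
  next
    case False
    \<comment> \<open>The piece from \<open>x\<close> to \<open>y\<close> is cut at the first vertex
      \<open>k + 1\<close> after \<open>x\<close> and the last vertex \<open>l\<close> up to
      \<open>y\<close>; only whole edges lie between them.\<close>
    define k where "k = \<lfloor>x\<rfloor>"
    define l where "l = \<lfloor>y\<rfloor>"
    have kl: "k + 1 \<le> l"
      using False floor_mono[OF that] unfolding k_def l_def by linarith
    have 1: "norm (polygon a y - a l) \<le> frac y * D"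
      unfolding l_def by (rule polygon_minus_vertex[of a D, OF assms])
    have 2: "norm (a l - a (k + 1)) \<le> (of_int l - of_int (k + 1)) * D"
      using norm_diff_le_steps[OF kl, of a D] assms by blast
    have "a (k + 1) - polygon a x = (1 - frac x) *\<^sub>R (a (k + 1) - a k)"
      unfolding k_def by (simp add: polygon_def algebra_simps)
    then have 3: "norm (a (k + 1) - polygon a x) \<le> (1 - frac x) * D"
      using frac_lt_1[of x] assms[of k] by (simp add: mult_left_mono)
    have "norm (polygon a y - polygon a x)
        = norm ((polygon a y - a l) + (a l - a (k + 1)) + (a (k + 1) - polygon a x))"
      by simp
    also have "\<dots> \<le> frac y * D + (of_int l - of_int (k + 1)) * D + (1 - frac x) * D"
      by (intro order_trans[OF norm_triangle_ineq] add_mono 1 2 3)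
    also have "\<dots> = D * (y - x)"
      unfolding k_def l_def frac_def by (simp add: algebra_simps)
    finally show ?thesis .
  qed
  show ?thesis
  proof (cases "x \<le> y")
    case False
    then show ?thesis using *[of y x] by (simp add: norm_minus_commute)
  qed (use * in auto)
qed

lemma periodic_int:
  fixes a :: "int \<Rightarrow> 'a"
  assumes "\<And>i. a (i + N) = a i"
  shows "a (i + k * N) = a i"
proof -
  have nat: "a (i + int n * N) = a i" for n i
  proof (induction n)
    case (Suc n)
    have "i + int (Suc n) * N = (i + int n * N) + N" by (simp add: algebra_simps)
    then show ?case using Suc assms by metis
  qed simp
  show ?thesis
  proof (cases "k \<ge> 0")
    case True
    then show ?thesis using nat[of i "nat k"] by simp
  next
    case False
    then show ?thesis using nat[of "i + k * N" "nat (- k)"] by simp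
  qed
qed

lemma periodic_int_mod:
  fixes a :: "int \<Rightarrow> 'a"
  assumes "\<And>i. a (i + N) = a i"
  shows "a (i mod N) = a i"
  using periodic_int[of a N "i mod N" "i div N", OF assms] by simp

lemma periodic_int_bounded:
  fixes a :: "int \<Rightarrow> 'a::real_normed_vector"
  assumes "\<And>i. a (i + N) = a i" "N > 0"
  obtains D where "\<And>i. norm (a i) \<le> D"
proof -
  have "norm (a i) \<le> (\<Sum>j\<in>{0..<N}. norm (a j))" for i
  proof -
    have "norm (a (i mod N)) \<le> (\<Sum>j\<in>{0..<N}. norm (a j))"
      using assms(2) by (intro member_le_sum) auto
    then show ?thesis using periodic_int_mod[of a N, OF assms(1)] by simp
  qed
  then show ?thesis using that by blast
qed

lemma polygon_shift:
  assumes "\<And>i. a (i + N) = a i"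
  shows "polygon a (x + of_int N) = polygon a x"
proof -
  have "a (\<lfloor>x\<rfloor> + N + 1) = a (\<lfloor>x\<rfloor> + 1)"
    using assms[of "\<lfloor>x\<rfloor> + 1"] by (simp add: add.assoc add.commute[of 1])
  then show ?thesis
    unfolding polygon_def using assms[of "\<lfloor>x\<rfloor>"] by (simp add: frac_def)
qed

lemma continuous_on_polygon:
  assumes "\<And>i. a (i + N) = a i" "N > 0"
  shows "continuous_on A (polygon a)"
proof -
  obtain D where D: "\<And>i. norm (a i) \<le> D" using periodic_int_bounded[of a N] assms by blast
  have "norm (a (i + 1) - a i) \<le> 2 * D" for i
    using norm_triangle_ineq4[of "a (i + 1)" "a i"] D[of i] D[of "i + 1"] by linarith
  from polygon_lipschitz[of a, OF this]
  have "(2 * D)-lipschitz_on UNIV (polygon a)"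
    using D[of 0] norm_ge_zero[of "a 0"]
    by (intro lipschitz_onI) (auto simp: dist_norm simp del: norm_ge_zero)
  then show ?thesis
    by (meson lipschitz_on_continuous_on continuous_on_subset subset_UNIV)
qed

section \<open>Limits of one-step schemes\<close>

lemma floor_mult_tendsto:
  fixes h :: "nat \<Rightarrow> real"
  assumes "\<And>k. h k > 0" "h \<longlonglongrightarrow> 0"
  shows "(\<lambda>k. of_int \<lfloor>t / h k\<rfloor> * h k) \<longlonglongrightarrow> t"
proof (rule LIM_zero_cancel, rule Lim_null_comparison[OF _ assms(2)], rule always_eventually, rule allI)
  fix k
  have "(t / h k - of_int \<lfloor>t / h k\<rfloor>) * h k \<le> 1 * h k"
    by (intro mult_right_mono) (use assms(1)[of k] in \<open>linarith+\<close>)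
  moreover have "(t / h k - of_int \<lfloor>t / h k\<rfloor>) * h k \<ge> 0"
    by (intro mult_nonneg_nonneg) (use assms(1)[of k] in \<open>linarith+\<close>)
  ultimately show "norm (of_int \<lfloor>t / h k\<rfloor> * h k - t) \<le> h k"
    using assms(1)[of k] by (simp add: algebra_simps)
qed

text \<open>Peano's argument for explicit Euler steps with an error of o(h) each.
  \<open>\<Phi>\<close> is merely continuous, so solutions need not be unique and only a subsequence
  converges. The derivative of the limit is read off from sums of increments, without an integral
  equation. Periodicity makes the convergence uniform on the whole line, which later identifies the
  homotopy class of the limit.\<close>

theorem euler_limit:
  fixes z :: "nat \<Rightarrow> int \<Rightarrow> 'b::euclidean_space" and h \<epsilon> :: "nat \<Rightarrow> real" and N :: "nat \<Rightarrow> int"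
  assumes C: "compact C" and \<Phi>: "continuous_on C \<Phi>"
    and zC: "\<And>k i. z k i \<in> C"
    and per: "\<And>k i. z k (i + N k) = z k i"
    and h: "\<And>k. h k > 0" "h \<longlonglongrightarrow> 0" and hN: "\<And>k. h k * of_int (N k) = \<omega>" and \<omega>: "\<omega> > 0"
    and step: "\<And>k i. norm (z k (i + 1) - z k i - h k *\<^sub>R \<Phi> (z k i)) \<le> \<epsilon> k * h k"
    and \<epsilon>: "\<epsilon> \<longlonglongrightarrow> 0"
  obtains Z r where "strict_mono (r :: nat \<Rightarrow> nat)" "\<And>t. Z t \<in> C" "\<And>t. Z (t + \<omega>) = Z t"
    "\<And>t. (Z has_vector_derivative \<Phi> (Z t)) (at t)"
    "\<And>e. e > 0 \<Longrightarrow> \<exists>K. \<forall>k\<ge>K. \<forall>t. norm (polygon (z (r k)) (t / h (r k)) - Z t) < e"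
proof -
  obtain B where B: "\<And>x. x \<in> C \<Longrightarrow> norm (\<Phi> x) \<le> B"
    using compact_imp_bounded[OF compact_continuous_image[OF \<Phi> C]]
    by (auto simp: bounded_iff)
  obtain E where E: "\<And>k. norm (\<epsilon> k) \<le> E"
    using \<epsilon> by (meson BseqE convergentI convergent_imp_Bseq)
  obtain R where R: "C \<subseteq> cball 0 R"
    using compact_imp_bounded[OF C] unfolding bounded_iff by (meson mem_cball_0 subsetI)
  define D where "D = B + E"
  have D0: "D \<ge> 0"
    using order_trans[OF norm_ge_zero B[OF zC[of 0 0]]] order_trans[OF norm_ge_zero E[of 0]]
    by (simp add: D_def)
  have zstep: "norm (z k (i + 1) - z k i) \<le> D * h k" for k i
  proof -
    have "norm (z k (i + 1) - z k i)
        \<le> norm (z k (i + 1) - z k i - h k *\<^sub>R \<Phi> (z k i)) + norm (h k *\<^sub>R \<Phi> (z k i))"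
      by (metis diff_add_cancel norm_triangle_ineq)
    also have "\<dots> \<le> E * h k + h k * B"
    proof (rule add_mono)
      have "\<epsilon> k * h k \<le> E * h k" using E[of k] h(1)[of k] by (intro mult_right_mono) auto
      then show "norm (z k (i + 1) - z k i - h k *\<^sub>R \<Phi> (z k i)) \<le> E * h k"
        using step[of k i] by linarith
      show "norm (h k *\<^sub>R \<Phi> (z k i)) \<le> h k * B"
        using h(1)[of k] B[OF zC[of k i]] by simp
    qed
    finally show ?thesis by (simp add: D_def algebra_simps)
  qed
  define F where "F k t = polygon (z k) (t / h k)" for k t
  have Flip: "norm (F k t - F k s) \<le> D * \<bar>t - s\<bar>" for k s t
  proof -
    have "norm (F k t - F k s) \<le> D * h k * \<bar>t / h k - s / h k\<bar>"
      unfolding F_def by (rule polygon_lipschitz) (rule zstep)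
    also have "\<bar>t / h k - s / h k\<bar> = \<bar>t - s\<bar> / h k"
      using h(1)[of k] by (simp flip: diff_divide_distrib)
    finally show ?thesis using h(1)[of k] by simp
  qed
  have Fbd: "norm (F k t) \<le> R" for k t
    using polygon_in_convex[of "cball 0 R" "z k"] R zC by (fastforce simp: F_def)
  have Fper: "F k (t + of_int m * \<omega>) = F k t" for k t m
  proof -
    have "(t + of_int m * \<omega>) / h k = t / h k + of_int (m * N k)"
      using h(1)[of k] by (simp add: hN[of k, symmetric] field_simps)
    moreover have "z k (i + m * N k) = z k i" for i by (rule periodic_int) (rule per)
    ultimately show ?thesis
      unfolding F_def by (simp only: polygon_shift)
  qed
  have Fz: "norm (F k t - z k \<lfloor>t / h k\<rfloor>) \<le> D * h k" for k t
    unfolding F_def by (rule polygon_minus_vertex_le) (rule zstep)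
  obtain G r where r: "strict_mono (r :: nat \<Rightarrow> nat)"
    and conv: "\<And>e. 0 < e \<Longrightarrow> \<exists>K. \<forall>n x. n \<ge> K \<and> x \<in> {0..\<omega>} \<longrightarrow> norm (F (r n) x - G x) < e"
  proof (rule Arzela_Ascoli[of "{0..\<omega>}" F R])
    fix x e :: real assume "0 < e"
    show "\<exists>d. 0 < d \<and> (\<forall>n y. y \<in> {0..\<omega>} \<and> norm (x - y) < d \<longrightarrow> norm (F n x - F n y) < e)"
    proof (intro exI[of _ "e / (D + 1)"] conjI allI impI)
      show "0 < e / (D + 1)" using \<open>0 < e\<close> D0 by simp
      fix n y assume "y \<in> {0..\<omega>} \<and> norm (x - y) < e / (D + 1)"
      then have lt: "\<bar>x - y\<bar> * (D + 1) < e" using D0 by (simp add: field_simps)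
      have "norm (F n x - F n y) \<le> D * \<bar>x - y\<bar>" by (rule Flip)
      also have "\<dots> \<le> \<bar>x - y\<bar> * (D + 1)" by (simp add: algebra_simps)
      finally show "norm (F n x - F n y) < e" using lt by linarith
    qed
  qed (use Fbd in auto)
  \<comment> \<open>Arzela-Ascoli yields the limit on one period only; \<open>Z\<close> is its
    periodic extension, and \<open>Fper\<close> carries the uniform estimate along.\<close>
  define Z where "Z t = G (t - of_int \<lfloor>t / \<omega>\<rfloor> * \<omega>)" for t
  have unif: "\<exists>K. \<forall>k\<ge>K. \<forall>t. norm (F (r k) t - Z t) < e" if e: "e > 0" for e
  proof -
    obtain K where K: "\<And>n x. n \<ge> K \<Longrightarrow> x \<in> {0..\<omega>} \<Longrightarrow> norm (F (r n) x - G x) < e"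
      using conv[OF e] by blast
    have "norm (F (r k) t - Z t) < e" if "k \<ge> K" for k t
    proof -
      let ?x = "t - of_int \<lfloor>t / \<omega>\<rfloor> * \<omega>"
      have "of_int \<lfloor>t / \<omega>\<rfloor> * \<omega> \<le> t"
        using mult_right_mono[OF of_int_floor_le[of "t / \<omega>"], of \<omega>] \<omega> by simp
      moreover have "t \<le> (of_int \<lfloor>t / \<omega>\<rfloor> + 1) * \<omega>"
        using mult_right_mono[OF less_imp_le[OF floor_correct[of "t / \<omega>", THEN conjunct2]], of \<omega>] \<omega>
        by simp
      ultimately have "?x \<in> {0..\<omega>}" by (simp add: algebra_simps)
      from K[OF that this] have "norm (F (r k) ?x - Z t) < e" by (simp add: Z_def)
      then show ?thesis using Fper[of "r k" ?x "\<lfloor>t / \<omega>\<rfloor>"] by simp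
    qed
    then show ?thesis by blast
  qed
  have lim: "(\<lambda>k. F (r k) t) \<longlonglongrightarrow> Z t" for t
    by (rule LIMSEQ_I) (use unif in blast)
  have hr: "(\<lambda>k. h (r k)) \<longlonglongrightarrow> 0"
    using LIMSEQ_subseq_LIMSEQ[OF h(2) r] by (simp add: o_def)
  have \<epsilon>r: "(\<lambda>k. \<epsilon> (r k)) \<longlonglongrightarrow> 0"
    using LIMSEQ_subseq_LIMSEQ[OF \<epsilon> r] by (simp add: o_def)
  have zlim: "(\<lambda>k. z (r k) \<lfloor>t / h (r k)\<rfloor>) \<longlonglongrightarrow> Z t" for t
  proof -
    have "(\<lambda>k. F (r k) t - z (r k) \<lfloor>t / h (r k)\<rfloor>) \<longlonglongrightarrow> 0"
    proof (rule Lim_null_comparison)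
      show "\<forall>\<^sub>F k in sequentially. norm (F (r k) t - z (r k) \<lfloor>t / h (r k)\<rfloor>) \<le> D * h (r k)"
        using Fz by simp
      show "(\<lambda>k. D * h (r k)) \<longlonglongrightarrow> 0" using tendsto_mult_left[OF hr, of D] by simp
    qed
    from tendsto_diff[OF lim[of t] this] show ?thesis by simp
  qed
  have ZC: "Z t \<in> C" for t
    by (rule closed_sequentially[OF compact_imp_closed[OF C] _ zlim]) (rule zC)
  have Zper: "Z (t + \<omega>) = Z t" for t
  proof -
    have "(\<lambda>k. F (r k) (t + \<omega>)) \<longlonglongrightarrow> Z t"
      using lim[of t] Fper[of _ t 1] by simp
    then show ?thesis using lim[of "t + \<omega>"] LIMSEQ_unique by blast
  qed
  \<comment> \<open>Letting both ends \<open>s \<le> t\<close> vary near \<open>t0\<close> covers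
    the left and the right derivative at once.\<close>
  have est: "\<exists>\<eta>>0. \<forall>s t. s \<le> t \<longrightarrow> \<bar>s - t0\<bar> < \<eta> \<longrightarrow> \<bar>t - t0\<bar> < \<eta> \<longrightarrow>
      norm (Z t - Z s - (t - s) *\<^sub>R \<Phi> (Z t0)) \<le> e * (t - s)" if e: "e > 0" for e t0
  proof -
    let ?c = "\<Phi> (Z t0)"
    obtain d where d: "d > 0" "\<And>x. x \<in> C \<Longrightarrow> dist x (Z t0) < d \<Longrightarrow> dist (\<Phi> x) ?c < e"
      using \<Phi> ZC[of t0] e unfolding continuous_on_iff by blast
    \<comment> \<open>Grid times between \<open>s\<close> and \<open>t\<close> lie within
      \<open>2 * \<eta>\<close> of \<open>t0\<close>: one \<open>\<eta>\<close> for the window and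
      one for rounding \<open>s\<close> down to the grid. The remaining \<open>d / 3\<close> pays
      for replacing \<open>F\<close> by \<open>Z\<close> at \<open>t0\<close>.\<close>
    define \<eta> where "\<eta> = d / (3 * (D + 1))"
    have \<eta>: "\<eta> > 0" "2 * (D * \<eta>) + d / 3 \<le> d"
      using d(1) D0 by (auto simp: \<eta>_def field_simps)
    have "norm (Z t - Z s - (t - s) *\<^sub>R ?c) \<le> e * (t - s)"
      if st: "s \<le> t" "\<bar>s - t0\<bar> < \<eta>" "\<bar>t - t0\<bar> < \<eta>" for s t
    proof -
      \<comment> \<open>Uniform motion with velocity \<open>?c\<close> is subtracted, so that each
        increment of \<open>a\<close> is at most \<open>h * (e + \<epsilon>)\<close> and the
        increments simply add up.\<close>
      define a where "a k l = z k l - (of_int l * h k) *\<^sub>R ?c" for k l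
      have alim: "(\<lambda>k. a (r k) \<lfloor>t / h (r k)\<rfloor>) \<longlonglongrightarrow> Z t - t *\<^sub>R ?c" for t
        unfolding a_def by (intro tendsto_intros zlim floor_mult_tendsto h(1) hr)
      have "\<forall>\<^sub>F k in sequentially. h (r k) < \<eta>"
        using order_tendstoD(2)[OF hr \<eta>(1)] .
      moreover have "\<forall>\<^sub>F k in sequentially. norm (F (r k) t0 - Z t0) < d / 3"
        using tendstoD[OF lim[of t0], of "d / 3"] d(1) by (simp add: dist_norm)
      ultimately have ev: "\<forall>\<^sub>F k in sequentially.
          norm (a (r k) \<lfloor>t / h (r k)\<rfloor> - a (r k) \<lfloor>s / h (r k)\<rfloor>)
          \<le> (of_int \<lfloor>t / h (r k)\<rfloor> * h (r k) - of_int \<lfloor>s / h (r k)\<rfloor> * h (r k)) * (e + \<epsilon> (r k))"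
      proof eventually_elim
        case (elim k)
        define H where "H = h (r k)"
        define i where "i = \<lfloor>s / H\<rfloor>"
        define j where "j = \<lfloor>t / H\<rfloor>"
        have H: "H > 0" using h(1) by (simp add: H_def)
        have ij: "i \<le> j" unfolding i_def j_def using st(1) H by (intro floor_mono divide_right_mono) auto
        have "norm (a (r k) (l + 1) - a (r k) l) \<le> H * (e + \<epsilon> (r k))" if l: "i \<le> l" "l < j" for l
        proof -
          have "of_int l * H \<le> t"
          proof -
            have "of_int l \<le> t / H" using l(2) unfolding j_def by linarith
            then show ?thesis using H by (simp add: field_simps)
          qed
          moreover have "s - H \<le> of_int l * H"
          proof -
            have "s / H - 1 \<le> of_int l" using l(1) unfolding i_def by linarith
            then show ?thesis using H by (simp add: field_simps)
          qed
          ultimately have "\<bar>of_int l * H - t0\<bar> \<le> 2 * \<eta>"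
            using st elim(1) unfolding H_def by linarith
          moreover have zF: "z (r k) l = F (r k) (of_int l * H)"
            using H unfolding F_def H_def by simp
          ultimately have "norm (z (r k) l - F (r k) t0) \<le> D * (2 * \<eta>)"
            using Flip[of "r k" "of_int l * H" t0] mult_left_mono[OF _ D0] by fastforce
          then have "dist (z (r k) l) (Z t0) < d"
            using elim(2) \<eta>(2) norm_triangle_ineq[of "z (r k) l - F (r k) t0" "F (r k) t0 - Z t0"]
            by (simp add: dist_norm)
          then have "norm (\<Phi> (z (r k) l) - ?c) < e"
            using d(2)[OF zC] by (simp add: dist_norm)
          then have 1: "norm (H *\<^sub>R (\<Phi> (z (r k) l) - ?c)) \<le> H * e" using H by simp
          have 2: "norm (z (r k) (l + 1) - z (r k) l - H *\<^sub>R \<Phi> (z (r k) l)) \<le> \<epsilon> (r k) * H"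
            unfolding H_def by (rule step)
          have "a (r k) (l + 1) - a (r k) l
             = (z (r k) (l + 1) - z (r k) l - H *\<^sub>R \<Phi> (z (r k) l)) + H *\<^sub>R (\<Phi> (z (r k) l) - ?c)"
            by (simp add: a_def H_def algebra_simps)
          then have "norm (a (r k) (l + 1) - a (r k) l) \<le> \<epsilon> (r k) * H + H * e"
            using norm_triangle_mono[OF 2 1] by simp
          then show ?thesis by (simp add: algebra_simps)
        qed
        from norm_diff_le_steps[OF ij, of "a (r k)", OF this]
        show ?case unfolding i_def j_def H_def by (simp add: algebra_simps)
      qed
      have "norm ((Z t - t *\<^sub>R ?c) - (Z s - s *\<^sub>R ?c)) \<le> (t - s) * (e + 0)"
      proof (rule tendsto_le[OF sequentially_bot _ _ ev])
        show "(\<lambda>k. (of_int \<lfloor>t / h (r k)\<rfloor> * h (r k) - of_int \<lfloor>s / h (r k)\<rfloor> * h (r k)) * (e + \<epsilon> (r k)))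
            \<longlonglongrightarrow> (t - s) * (e + 0)"
          by (intro tendsto_intros floor_mult_tendsto h(1) hr \<epsilon>r)
      qed (intro tendsto_intros alim)
      then show ?thesis by (simp add: algebra_simps)
    qed
    then show ?thesis using \<eta>(1) by blast
  qed
  have der: "(Z has_vector_derivative \<Phi> (Z t)) (at t)" for t
    unfolding has_vector_derivative_def has_derivative_at_alt
  proof (intro conjI allI impI)
    fix e :: real assume "0 < e"
    from est[OF this, of t] obtain \<eta> where \<eta>: "\<eta> > 0"
      "\<And>s u. s \<le> u \<Longrightarrow> \<bar>s - t\<bar> < \<eta> \<Longrightarrow> \<bar>u - t\<bar> < \<eta> \<Longrightarrow>
        norm (Z u - Z s - (u - s) *\<^sub>R \<Phi> (Z t)) \<le> e * (u - s)"
      by blast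
    have "norm (Z y - Z t - (y - t) *\<^sub>R \<Phi> (Z t)) \<le> e * norm (y - t)" if "norm (y - t) < \<eta>" for y
    proof (cases "t \<le> y")
      case True
      then show ?thesis using \<eta>(2)[of t y] \<eta>(1) that by simp
    next
      case False
      have "norm (Z t - Z y - (t - y) *\<^sub>R \<Phi> (Z t)) \<le> e * (t - y)"
        using \<eta>(2)[of y t] \<eta>(1) that False by simp
      moreover have "Z y - Z t - (y - t) *\<^sub>R \<Phi> (Z t) = - (Z t - Z y - (t - y) *\<^sub>R \<Phi> (Z t))"
        by (simp add: algebra_simps)
      ultimately show ?thesis using False by (simp only: norm_minus_cancel) simp
    qed
    then show "\<exists>d>0. \<forall>y. norm (y - t) < d \<longrightarrow> norm (Z y - Z t - (y - t) *\<^sub>R \<Phi> (Z t)) \<le> e * norm (y - t)"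
      using \<eta>(1) by blast
  qed (rule bounded_linear_scaleR_left)
  show ?thesis
    using that[OF r ZC Zper der] unif unfolding F_def by blast
qed

section \<open>Minimisers of the discrete action\<close>

lemma sum_periodic_int:
  fixes F :: "int \<Rightarrow> 'b::comm_monoid_add"
  assumes per: "\<And>i. F (i + N) = F i" and "N > 0"
  shows "(\<Sum>i\<in>{a..<a + N}. F i) = (\<Sum>i\<in>{0..<N}. F i)"
proof -
  have step: "(\<Sum>i\<in>{a + 1..<a + 1 + N}. F i) = (\<Sum>i\<in>{a..<a + N}. F i)" for a
  proof -
    have "{a..<a + N} = insert a {a + 1..<a + N}" "{a + 1..<a + 1 + N} = insert (a + N) {a + 1..<a + N}"
      using \<open>N > 0\<close> by auto
    then show ?thesis by (simp add: per)
  qed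
  show ?thesis
  proof (induction a rule: int_induct[where k = 0])
    case (step2 i)
    then show ?case using step[of "i - 1"] by simp
  qed (use step in auto)
qed

lemma periodic_variation_le_sum:
  fixes x :: "int \<Rightarrow> 'b::real_normed_vector"
  assumes per: "\<And>i. x (i + N) = x i" and N: "N > 0"
  shows "norm (x j - x i) \<le> (\<Sum>l\<in>{0..<N}. norm (x (l + 1) - x l))"
proof -
  have tri: "norm (x j - x i) \<le> (\<Sum>l\<in>{i..<j}. norm (x (l + 1) - x l))" if "i \<le> j" for i j
    using that
  proof (induction j rule: int_ge_induct)
    case (step j)
    have "{i..<j + 1} = insert j {i..<j}" using step by auto
    then show ?case
      using step norm_triangle_ineq[of "x (j + 1) - x j" "x j - x i"] by simp
  qed simp
  have *: "norm (x j - x i) \<le> (\<Sum>l\<in>{0..<N}. norm (x (l + 1) - x l))"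
    if "0 \<le> i" "i \<le> j" "j < N" for i j
    using tri[OF that(2)] sum_mono2[of "{0..<N}" "{i..<j}" "\<lambda>l. norm (x (l + 1) - x l)"] that
    by fastforce
  have "norm (x (j mod N) - x (i mod N)) \<le> (\<Sum>l\<in>{0..<N}. norm (x (l + 1) - x l))"
  proof (cases "i mod N \<le> j mod N")
    case True
    then show ?thesis using * N by simp
  next
    case False
    then show ?thesis using *[of "j mod N" "i mod N"] N by (simp add: norm_minus_commute)
  qed
  then show ?thesis using periodic_int_mod[of x N, OF per] by simp
qed

text \<open>Cauchy-Schwarz over one period, the discrete form of Hoelder continuity with exponent
  1/2. The factor \<open>N\<close> is harmless because it is applied with \<open>M\<close>
  proportional to \<open>h\<close>.\<close>

lemma periodic_variation_le:
  fixes x :: "int \<Rightarrow> 'b::real_normed_vector"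
  assumes per: "\<And>i. x (i + N) = x i" and N: "N > 0"
    and le: "(\<Sum>i\<in>{0..<N}. (norm (x (i + 1) - x i))\<^sup>2) \<le> M"
  shows "norm (x j - x i) \<le> sqrt (of_int N * M)"
proof -
  have "norm (x j - x i) \<le> (\<Sum>l\<in>{0..<N}. norm (x (l + 1) - x l))"
    by (rule periodic_variation_le_sum[of x N, OF per N])
  also have "\<dots> \<le> sqrt (of_int N * M)"
  proof (rule real_le_rsqrt)
    have "(\<Sum>l\<in>{0..<N}. norm (x (l + 1) - x l))\<^sup>2
        \<le> (\<Sum>l\<in>{0..<N}. (norm (x (l + 1) - x l))\<^sup>2) * of_nat (card {0..<N})"
      by (rule sum_squared_le_sum_of_squares)
    also have "\<dots> \<le> M * of_nat (card {0..<N})"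
      by (intro mult_right_mono le) auto
    finally show "(\<Sum>l\<in>{0..<N}. norm (x (l + 1) - x l))\<^sup>2 \<le> of_int N * M"
      using N by (simp add: mult.commute)
  qed
  finally show ?thesis .
qed

section \<open>Polygons as loops and their homotopies\<close>

lemma polygon_path:
  assumes "\<And>i. q (i + N) = q i" "N > 0"
  shows "path (\<lambda>s. polygon q (of_int N * s))"
    "pathfinish (\<lambda>s. polygon q (of_int N * s)) = pathstart (\<lambda>s. polygon q (of_int N * s))"
proof -
  show "path (\<lambda>s. polygon q (of_int N * s))"
    unfolding path_def
    by (rule continuous_on_compose2[OF continuous_on_polygon[of q N UNIV]])
       (use assms in \<open>auto intro!: continuous_intros\<close>)
  show "pathfinish (\<lambda>s. polygon q (of_int N * s)) = pathstart (\<lambda>s. polygon q (of_int N * s))"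
    using assms(1)[of 0] by (simp add: pathfinish_def pathstart_def)
qed

text \<open>Each point of the polygon is within \<open>\<delta> / 2\<close> of a vertex, hence at
  distance at least \<open>\<delta> / 2\<close> from the complement of \<open>S\<close>, and a curve
  closer than that is joined to it by straight segments in \<open>S\<close>. This serves both the
  limit of a minimising sequence and the limit of the meshes.\<close>

lemma homotopic_loops_polygon:
  fixes S :: "'a::euclidean_space set"
  assumes q: "\<And>i. q (i + N) = q i" "N > 0"
    and ball: "\<And>i. ball (q i) \<delta> \<subseteq> S" and step: "\<And>i. norm (q (i + 1) - q i) \<le> \<delta> / 2"
    and p: "path p" "pathfinish p = pathstart p"
    and near: "\<And>s. norm (p s - polygon q (of_int N * s)) < \<delta> / 2"
  shows "homotopic_loops S (\<lambda>s. polygon q (of_int N * s)) p"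
proof (rule homotopic_loops_nearby_explicit)
  fix t x assume "x \<notin> S"
  let ?p = "polygon q (of_int N * t)" and ?v = "q \<lfloor>of_int N * t\<rfloor>"
  have "norm (?p - ?v) \<le> \<delta> / 2"
    by (rule polygon_minus_vertex_le) (rule step)
  moreover have "\<delta> \<le> norm (?v - x)"
    using ball[of "\<lfloor>of_int N * t\<rfloor>"] \<open>x \<notin> S\<close> by (force simp: dist_norm)
  ultimately show "norm (p t - ?p) < norm (?p - x)"
    using near[of t] norm_triangle_ineq[of "?v - ?p" "?p - x"] by (simp add: norm_minus_commute)
qed (use polygon_path[of q N] q p in auto)

text \<open>\<open>S\<close> is the punctured domain, \<open>G\<close> the gradient and
  \<open>H\<close> the Hessian of \<open>f\<close>. The singularities enter through
  \<open>barrier\<close>: a lower bound on \<open>f\<close> keeps a definite distance from the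
  complement of \<open>S\<close>. Boundedness is asked of that complement, so that loops far away
  can be contracted. The condition \<open>f_le_0\<close> makes the potential part of the action
  nonnegative.\<close>

locale sliding_surface =
  fixes S :: "'a::euclidean_space set" and f :: "'a \<Rightarrow> real" and G :: "'a \<Rightarrow> 'a"
    and H :: "'a \<Rightarrow> 'a \<Rightarrow> 'a" and g :: real
  assumes open_S: "open S" and bounded_S: "bounded (- S)"
    and grad_f: "q \<in> S \<Longrightarrow> GDERIV f q :> G q"
    and hess_f: "q \<in> S \<Longrightarrow> (G has_derivative H q) (at q)"
    and hess_sym: "q \<in> S \<Longrightarrow> H q u \<bullet> v = u \<bullet> H q v"
    and cont_hess: "continuous_on (S \<times> UNIV) (\<lambda>(q, u). H q u)"
    and f_le_0: "q \<in> S \<Longrightarrow> f q \<le> 0"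
    and g_pos: "g > 0"
    and barrier: "\<And>C. \<exists>\<delta>>0. \<forall>q\<in>S. - C \<le> f q \<longrightarrow> ball q \<delta> \<subseteq> S"
begin

lemma f_isCont: "q \<in> S \<Longrightarrow> isCont f q"
  using grad_f has_derivative_continuous unfolding gderiv_def by blast

text \<open>Action of one edge over time \<open>h\<close>, divided by the mass. The difference
  \<open>f y - f x\<close> stands for \<open>h\<close> times d/dt f rather than
  \<open>G x \<bullet> (y - x)\<close>: in this way the action bounds the oscillation of
  \<open>f\<close> over the vertices without any knowledge of \<open>G\<close>. The potential is
  evaluated at the left end.\<close>

definition cell :: "real \<Rightarrow> 'a \<Rightarrow> 'a \<Rightarrow> real" where
  "cell h x y = ((norm (y - x))\<^sup>2 + (f y - f x)\<^sup>2) / (2 * h) - h * g * f x"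

definition action :: "real \<Rightarrow> int \<Rightarrow> (int \<Rightarrow> 'a) \<Rightarrow> real" where
  "action h N q = (\<Sum>i\<in>{0..<N}. cell h (q i) (q (i + 1)))"

text \<open>\<open>homotopic_loops\<close> includes that the whole polygon lies in \<open>S\<close>,
  so edges as well as vertices avoid the complement.\<close>

definition admissible :: "(real \<Rightarrow> 'a) \<Rightarrow> int \<Rightarrow> (int \<Rightarrow> 'a) \<Rightarrow> bool" where
  "admissible \<kappa> N q \<longleftrightarrow> (\<forall>i. q (i + N) = q i) \<and>
     homotopic_loops S \<kappa> (\<lambda>s. polygon q (of_int N * s))"

lemma admissible_periodic: "admissible \<kappa> N q \<Longrightarrow> q (i + N) = q i"
  by (simp add: admissible_def)

lemma admissible_in:
  assumes "admissible \<kappa> N q" "N > 0"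
  shows "q i \<in> S"
proof -
  have "path_image (\<lambda>s. polygon q (of_int N * s)) \<subseteq> S"
    using assms homotopic_loops_imp_subset unfolding admissible_def by blast
  moreover have "of_int (i mod N) / of_int N \<in> {0..1::real}"
    using assms(2) pos_mod_bound[of N i] by (simp add: less_imp_le del: pos_mod_bound)
  ultimately have "polygon q (of_int N * (of_int (i mod N) / of_int N)) \<in> S"
    unfolding path_image_def by blast
  then have "q (i mod N) \<in> S" using assms(2) by simp
  then show ?thesis
    using periodic_int_mod[of q N i] admissible_periodic[OF assms(1)] by simp
qed

text \<open>Both parts of the action are nonnegative, so each is at most \<open>c\<close>. The
  kinetic part bounds the steps and the variation of \<open>q\<close> and of \<open>f\<close>; the
  potential part bounds \<open>- f\<close> at one vertex, and the variation of \<open>f\<close>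
  spreads this to all vertices. For \<open>N * h = \<omega>\<close> the last two bounds are
  independent of the mesh.\<close>

lemma action_bounds:
  assumes q: "admissible \<kappa> N q" and N: "N > 0" and h: "h > 0" and c: "action h N q \<le> c"
  shows "c \<ge> 0"
    and "(\<Sum>i\<in>{0..<N}. (norm (q (i + 1) - q i))\<^sup>2) \<le> 2 * h * c"
    and "(norm (q (i + 1) - q i))\<^sup>2 \<le> 2 * h * c"
    and "norm (q j - q i) \<le> sqrt (of_int N * (2 * h * c))"
    and "- (c / (g * (of_int N * h)) + sqrt (of_int N * (2 * h * c))) \<le> f (q i)"
proof -
  note qS = admissible_in[OF q N] and per = admissible_periodic[OF q]
  have f0: "f (q i) \<le> 0" for i using f_le_0 qS by blast
  have pot: "0 \<le> - (h * g * f (q i))" for i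
    using f0[of i] h g_pos by (simp add: mult_nonneg_nonpos)
  \<comment> \<open>Stated for any \<open>X\<close> below the kinetic numerator; it is used with
    zero, with the squared steps of \<open>q\<close> and with the squared steps of
    \<open>f\<close>.\<close>
  have sq: "(\<Sum>i\<in>{0..<N}. X i) \<le> 2 * h * c"
    if "\<And>i. X i \<le> (norm (q (i + 1) - q i))\<^sup>2 + (f (q (i + 1)) - f (q i))\<^sup>2" for X
  proof -
    have "(\<Sum>i\<in>{0..<N}. X i) = 2 * h * (\<Sum>i\<in>{0..<N}. X i / (2 * h))"
      using h by (simp add: sum_divide_distrib[symmetric])
    also have "(\<Sum>i\<in>{0..<N}. X i / (2 * h)) \<le> action h N q"
      unfolding action_def cell_def
    proof (rule sum_mono)
      fix i
      have "X i / (2 * h) \<le> ((norm (q (i + 1) - q i))\<^sup>2 + (f (q (i + 1)) - f (q i))\<^sup>2) / (2 * h)"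
        using that[of i] h by (intro divide_right_mono) auto
      then show "X i / (2 * h) \<le>
          ((norm (q (i + 1) - q i))\<^sup>2 + (f (q (i + 1)) - f (q i))\<^sup>2) / (2 * h) - h * g * f (q i)"
        using pot[of i] by linarith
    qed
    finally have "(\<Sum>i\<in>{0..<N}. X i) \<le> 2 * h * action h N q" using h by simp
    also have "\<dots> \<le> 2 * h * c" using h c by (intro mult_left_mono) auto
    finally show ?thesis .
  qed
  show c0: "c \<ge> 0"
    using sq[of "\<lambda>_. 0"] h by (simp add: zero_le_mult_iff)
  show sq1: "(\<Sum>i\<in>{0..<N}. (norm (q (i + 1) - q i))\<^sup>2) \<le> 2 * h * c"
    by (rule sq) simp
  have sq2: "(\<Sum>i\<in>{0..<N}. (norm (f (q (i + 1)) - f (q i)))\<^sup>2) \<le> 2 * h * c"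
    by (rule sq) simp
  show "(norm (q (i + 1) - q i))\<^sup>2 \<le> 2 * h * c"
  proof -
    have "(norm (q (i mod N + 1) - q (i mod N)))\<^sup>2 \<le> 2 * h * c"
      by (rule order_trans[OF member_le_sum[of "i mod N" "{0..<N}"] sq1]) (use N in auto)
    moreover have "q (i mod N + 1) = q (i + 1)"
      using periodic_int[of q N "i mod N + 1" "i div N", OF per]
      by (simp add: algebra_simps)
    ultimately show ?thesis using periodic_int_mod[of q N i, OF per] by simp
  qed
  show "norm (q j - q i) \<le> sqrt (of_int N * (2 * h * c))"
    by (rule periodic_variation_le[OF per N sq1])
  have fvar: "norm (f (q j) - f (q i)) \<le> sqrt (of_int N * (2 * h * c))" for i j
    by (rule periodic_variation_le[of "\<lambda>i. f (q i)", OF _ N sq2]) (simp add: per)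
  \<comment> \<open>The potential terms \<open>- h * g * f\<close> add up to at most
    \<open>c\<close>, so some vertex is not above the average.\<close>
  have "\<exists>j\<in>{0..<N}. - f (q j) \<le> c / (g * (of_int N * h))"
  proof (rule ccontr)
    assume "\<not> ?thesis"
    then have "c / (g * (of_int N * h)) < - f (q j)" if "j \<in> {0..<N}" for j
      using that by force
    then have "h * g * (c / (g * (of_int N * h))) < - (h * g * f (q j))" if "j \<in> {0..<N}" for j
      using that mult_strict_left_mono[of "c / (g * (of_int N * h))" "- f (q j)" "h * g"] h g_pos
      by simp
    then have "(\<Sum>j\<in>{0..<N}. h * g * (c / (g * (of_int N * h)))) < (\<Sum>j\<in>{0..<N}. - (h * g * f (q j)))"
      using N by (intro sum_strict_mono) auto
    also have "\<dots> \<le> action h N q"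
      unfolding action_def cell_def using h by (intro sum_mono) simp
    also have "\<dots> \<le> c" by (rule c)
    finally show False using N h g_pos by simp
  qed
  then obtain j where "- f (q j) \<le> c / (g * (of_int N * h))" by blast
  then show "- (c / (g * (of_int N * h)) + sqrt (of_int N * (2 * h * c))) \<le> f (q i)"
    using fvar[of j i] by (simp add: real_norm_def)
qed

lemma admissible_bounded:
  assumes q: "admissible \<kappa> N q" and N: "N > 0"
    and null: "\<And>a. \<not> homotopic_loops S \<kappa> (\<lambda>_. a)"
    and diam: "\<And>i. norm (q i - q 0) \<le> l" and R: "- S \<subseteq> cball 0 R"
  shows "norm (q i) \<le> R + 2 * l"
proof -
  \<comment> \<open>One \<open>l\<close> locates \<open>q 0\<close>; the second one reaches the
    other vertices.\<close>
  have "norm (q 0) \<le> R + l"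
  proof (rule ccontr)
    assume far: "\<not> norm (q 0) \<le> R + l"
    have sub: "cball (q 0) l \<subseteq> S"
    proof (intro subsetI, rule ccontr)
      fix x assume "x \<in> cball (q 0) l" "x \<notin> S"
      then have "norm x \<le> R" "norm (q 0 - x) \<le> l" using R by (auto simp: dist_norm)
      then show False
        using far norm_triangle_ineq[of "q 0 - x" x] by simp
    qed
    have pin: "polygon q x \<in> cball (q 0) l" for x
      by (rule polygon_in_convex) (use diam in \<open>auto simp: dist_norm norm_minus_commute\<close>)
    have c0: "q 0 \<in> cball (q 0) l" using pin[of 0] by simp
    have "homotopic_loops S (\<lambda>s. polygon q (of_int N * s)) (\<lambda>_. q 0)"
    proof (rule homotopic_loops_linear)
      fix t
      show "closed_segment (polygon q (of_int N * t)) (q 0) \<subseteq> S"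
        using closed_segment_subset[OF pin c0] sub by fastforce
    qed (use polygon_path[of q N] admissible_periodic[OF q] N in
        \<open>auto simp: path_def pathfinish_def pathstart_def\<close>)
    then show False
      using q null homotopic_loops_trans unfolding admissible_def by blast
  qed
  then show ?thesis
    using diam[of i] norm_triangle_ineq[of "q i - q 0" "q 0"] by simp
qed

text \<open>There are finitely many vertices per period, all bounded, so a minimising sequence
  converges vertexwise. The class survives the limit because \<open>small\<close> makes every edge
  at most \<open>\<delta> / 2\<close> while the vertices keep distance \<open>\<delta>\<close> from
  the complement of \<open>S\<close>.\<close>

lemma minimizer_exists:
  assumes q0: "admissible \<kappa> N q0" "action h N q0 \<le> c" and N: "N > 0" and h: "h > 0"
    and null: "\<And>a. \<not> homotopic_loops S \<kappa> (\<lambda>_. a)"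
    and \<delta>: "\<delta> > 0"
      "\<And>x. x \<in> S \<Longrightarrow> - (c / (g * (of_int N * h)) + sqrt (of_int N * (2 * h * c))) \<le> f x \<Longrightarrow> ball x \<delta> \<subseteq> S"
    and small: "2 * h * c \<le> (\<delta> / 2)\<^sup>2"
  obtains q where "admissible \<kappa> N q" "action h N q \<le> c"
    "\<And>q'. admissible \<kappa> N q' \<Longrightarrow> action h N q \<le> action h N q'"
proof -
  define A where "A = action h N ` Collect (admissible \<kappa> N)"
  have A0: "0 \<le> x" if "x \<in> A" for x
    using that action_bounds(1)[OF _ N h order_refl] unfolding A_def by blast
  then have bdd: "bdd_below A" by (meson bdd_belowI)
  have ne: "A \<noteq> {}" using q0 unfolding A_def by blast
  \<comment> \<open>The minimising sequence must also obey the bound \<open>c\<close>, since the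
    distance \<open>\<delta>\<close> depends on it. Where \<open>q0\<close> is not close enough to
    the infimum, a closer competitor has smaller action than \<open>q0\<close>.\<close>
  have "\<exists>q. admissible \<kappa> N q \<and> action h N q \<le> c \<and> action h N q \<le> Inf A + 1 / real (Suc k)" for k
  proof (cases "action h N q0 \<le> Inf A + 1 / real (Suc k)")
    case True
    then show ?thesis using q0 by blast
  next
    case False
    have "Inf A < Inf A + 1 / real (Suc k)" by simp
    then obtain x where "x \<in> A" "x < Inf A + 1 / real (Suc k)"
      using cInf_lessD[OF ne] by blast
    then show ?thesis using False q0(2) unfolding A_def by fastforce
  qed
  then obtain P where P: "\<And>k. admissible \<kappa> N (P k)" "\<And>k. action h N (P k) \<le> c"
    "\<And>k. action h N (P k) \<le> Inf A + 1 / real (Suc k)"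
    by metis
  note PS = admissible_in[OF P(1) N]
  note bnd = action_bounds[OF P(1) N h P(2)]
  have ballP: "ball (P k i) \<delta> \<subseteq> S" for k i
    by (rule \<delta>(2)[OF PS bnd(5)])
  have stepP: "norm (P k (i + 1) - P k i) \<le> \<delta> / 2" for k i
    using order_trans[OF bnd(3) small] \<delta>(1) by (simp add: abs_le_square_iff[symmetric])
  obtain R where R: "- S \<subseteq> cball 0 R"
    using bounded_S unfolding bounded_iff by (meson mem_cball_0 subsetI)
  obtain r where r: "strict_mono (r :: nat \<Rightarrow> nat)"
    and "\<And>i. i \<in> UNIV \<Longrightarrow> \<exists>l. (\<lambda>k. P (r k) i) \<longlonglongrightarrow> l"
  proof (rule function_convergent_subsequence[of UNIV P])
    fix k i
    show "norm (P k i) \<le> R + 2 * sqrt (of_int N * (2 * h * c))"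
      by (rule admissible_bounded[OF P(1) N null bnd(4) R])
  qed (auto simp: LIMSEQ_def dist_norm)
  then obtain Q where Q: "\<And>i. (\<lambda>k. P (r k) i) \<longlonglongrightarrow> Q i" by (metis UNIV_I)
  have perQ: "Q (i + N) = Q i" for i
    using Q[of "i + N"] Q[of i] admissible_periodic[OF P(1)] LIMSEQ_unique by fastforce
  \<comment> \<open>Convergence is uniform over one period, hence over all indices by periodicity.
    The radius \<open>\<delta> / 4\<close> leaves room for the strict bound
    \<open>\<delta> / 2\<close> in \<open>homotopic_loops_polygon\<close>.\<close>
  have "\<forall>\<^sub>F k in sequentially. \<forall>i\<in>{0..<N}. norm (P (r k) i - Q i) < \<delta> / 4"
    using Q[THEN tendstoD, of "\<delta> / 4"] \<delta>(1) by (intro eventually_ball_finite) (auto simp: dist_norm)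
  then obtain k where k: "\<forall>i\<in>{0..<N}. norm (P (r k) i - Q i) < \<delta> / 4"
    using eventually_happens'[OF sequentially_bot] by blast
  have near: "norm (P (r k) i - Q i) < \<delta> / 4" for i
    using bspec[OF k, of "i mod N"] N
      periodic_int_mod[of Q N, OF perQ] periodic_int_mod[of "P (r k)" N, OF admissible_periodic[OF P(1)]]
    by simp
  have QS: "Q i \<in> S" for i
    using ballP[of "r k" i] near[of i] \<delta>(1) by (auto simp: dist_norm)
  have "homotopic_loops S (\<lambda>s. polygon (P (r k)) (of_int N * s)) (\<lambda>s. polygon Q (of_int N * s))"
  proof (rule homotopic_loops_polygon[of _ N \<delta>])
    fix s
    have "norm (polygon Q (of_int N * s) - polygon (P (r k)) (of_int N * s)) \<le> \<delta> / 4"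
      using near by (intro norm_polygon_diff_le) (simp add: norm_minus_commute less_imp_le)
    then show "norm (polygon Q (of_int N * s) - polygon (P (r k)) (of_int N * s)) < \<delta> / 2"
      using \<delta>(1) by linarith
  qed (use polygon_path[of Q N, OF perQ N] admissible_periodic[OF P(1)] N ballP stepP in auto)
  then have admQ: "admissible \<kappa> N Q"
    using P(1)[of "r k"] perQ homotopic_loops_trans unfolding admissible_def by blast
  have actlim: "(\<lambda>k. action h N (P (r k))) \<longlonglongrightarrow> action h N Q"
    unfolding action_def cell_def
    by (intro tendsto_intros Q isCont_tendsto_compose[OF f_isCont[OF QS]]) (use h in auto)
  have "(\<lambda>k. Inf A + 1 / real (Suc (r k))) \<longlonglongrightarrow> Inf A + 0"
    using LIMSEQ_subseq_LIMSEQ[OF LIMSEQ_inverse_real_of_nat r]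
    by (intro tendsto_intros) (simp add: o_def inverse_eq_divide)
  then have Qmin: "action h N Q \<le> Inf A"
    using LIMSEQ_le[OF actlim] P(3) by auto
  show ?thesis
  proof
    show "action h N Q \<le> c"
      using LIMSEQ_le_const2[OF actlim] P(2) by blast
    show "action h N Q \<le> action h N q'" if "admissible \<kappa> N q'" for q'
      using Qmin cInf_lower[OF _ bdd, of "action h N q'"] that unfolding A_def by fastforce
  qed (rule admQ)
qed

text \<open>A vertex enters the action through the two cells that meet there. The potential
  contributes once, from the cell in which the vertex is the left end.\<close>

lemma cell_derivative:
  assumes "x \<in> S" and h: "h \<noteq> 0"
  shows "((\<lambda>x. cell h a x + cell h x b) has_derivative
     (\<lambda>u. (((x - a) - (b - x) + ((f x - f a) - (f b - f x)) *\<^sub>R G x) /\<^sub>R h - (h * g) *\<^sub>R G x) \<bullet> u)) (at x)"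
proof -
  have f: "(f has_derivative (\<lambda>u. u \<bullet> G x)) (at x)"
    using grad_f[OF assms(1)] by (simp add: gderiv_def)
  have h2: "2 * h \<noteq> 0" using h by simp
  have "((\<lambda>x. cell h a x + cell h x b) has_derivative
     (\<lambda>u. (2 * (u \<bullet> (x - a)) + 2 * (f x - f a) * (u \<bullet> G x)) / (2 * h)
        + ((2 * (u \<bullet> (x - b)) + 2 * (f x - f b) * (u \<bullet> G x)) / (2 * h) - h * g * (u \<bullet> G x)))) (at x)"
    unfolding cell_def power2_norm_eq_inner
    by (rule derivative_eq_intros f refl h2)+
       (use h in \<open>simp add: fun_eq_iff inner_commute algebra_simps power2_eq_square divide_simps\<close>)
  then show ?thesis
    by (rule has_derivative_eq_rhs)
       (use h in \<open>simp add: fun_eq_iff inner_commute inner_diff_left inner_diff_right inner_add_right divide_simps algebra_simps\<close>)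
qed

text \<open>A small displacement of one vertex does not change the homotopy class, so the minimiser
  is a free local minimum in each vertex and the gradient there vanishes.\<close>

lemma minimizer_equation:
  assumes q: "admissible \<kappa> N q" and N: "N \<ge> 2" and h: "h > 0"
    and min: "\<And>q'. admissible \<kappa> N q' \<Longrightarrow> action h N q \<le> action h N q'"
  shows "(q j - q (j - 1)) - (q (j + 1) - q j)
      + ((f (q j) - f (q (j - 1))) - (f (q (j + 1)) - f (q j))) *\<^sub>R G (q j) = (h\<^sup>2 * g) *\<^sub>R G (q j)"
proof -
  note per = admissible_periodic[OF q]
  have N0: "N > 0" using N by simp
  \<comment> \<open>All vertices with index congruent to \<open>j\<close> move together, which keeps
    the sequence periodic; \<open>N \<ge> 2\<close> leaves the neighbours \<open>j - 1\<close> and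
    \<open>j + 1\<close> in place.\<close>
  define X where "X x i = (if N dvd (i - j) then x else q i)" for x i
  have perX: "X x (i + N) = X x i" for x i
  proof -
    have "i + N - j = (i - j) + N" by simp
    then show ?thesis by (simp only: X_def per dvd_add_triv_right_iff)
  qed
  have dvdq: "q i = q j" if "N dvd (i - j)" for i
  proof -
    from that obtain k where "i - j = N * k" by (elim dvdE)
    then have "i = j + k * N" by (simp add: algebra_simps)
    then show ?thesis using periodic_int[of q N j k, OF per] by simp
  qed
  have Xq: "X (q j) = q"
  proof
    show "X (q j) i = q i" for i using dvdq[of i] by (simp add: X_def)
  qed
  have nd: "X x i = q i" if "j < i" "i < j + N" for x i
    using that zdvd_imp_le[of N "i - j"] by (auto simp: X_def)
  define rest where "rest = (\<Sum>i\<in>{j + 1..<j - 1 + N}. cell h (q i) (q (i + 1)))"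
  have act: "action h N (X x) = cell h (q (j - 1)) x + cell h x (q (j + 1)) + rest" for x
  proof -
    \<comment> \<open>The window of summation starts at \<open>j - 1\<close>, so the two cells
      containing the moving vertex come first and \<open>rest\<close> does not depend on
      \<open>x\<close>.\<close>
    have "action h N (X x) = (\<Sum>i\<in>{j - 1..<j - 1 + N}. cell h (X x i) (X x (i + 1)))"
      unfolding action_def
      by (rule sum_periodic_int[symmetric]) (use N perX[of x] perX[of x "_ + 1"] in \<open>auto simp: algebra_simps\<close>)
    also have "{j - 1..<j - 1 + N} = insert (j - 1) (insert j {j + 1..<j - 1 + N})"
      using N by auto
    also have "(\<Sum>i\<in>\<dots>. cell h (X x i) (X x (i + 1)))
        = cell h (X x (j - 1)) (X x j) + (cell h (X x j) (X x (j + 1))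
          + (\<Sum>i\<in>{j + 1..<j - 1 + N}. cell h (X x i) (X x (i + 1))))"
      by simp
    also have "(\<Sum>i\<in>{j + 1..<j - 1 + N}. cell h (X x i) (X x (i + 1))) = rest"
      unfolding rest_def by (intro sum.cong refl) (auto simp: nd)
    also have "X x (j - 1) = q (j - 1)"
      using perX[of x "j - 1"] nd[of "j - 1 + N" x] N per[of "j - 1"] by simp
    also have "X x j = x" by (simp add: X_def)
    also have "X x (j + 1) = q (j + 1)" using N by (intro nd) auto
    finally show ?thesis by simp
  qed
  let ?\<phi> = "\<lambda>x. cell h (q (j - 1)) x + cell h x (q (j + 1))"
  let ?p = "\<lambda>q s. polygon q (of_int N * s)"
  have hom: "homotopic_loops S \<kappa> (?p q)" using q by (simp add: admissible_def)
  obtain e where e: "e > 0"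
    "\<And>p. path p \<Longrightarrow> pathfinish p = pathstart p \<Longrightarrow> (\<forall>t\<in>{0..1}. norm (p t - ?p q t) < e) \<Longrightarrow>
      homotopic_loops S (?p q) p"
    using homotopic_nearby_loops[of "?p q" S] polygon_path[of q N, OF per N0] open_S
      homotopic_loops_imp_subset[OF hom] by blast
  have min\<phi>: "?\<phi> (q j) \<le> ?\<phi> x" if "dist x (q j) < e" for x
  proof -
    have "norm (X x i - q i) \<le> dist x (q j)" for i
      using dvdq[of i] by (auto simp: X_def dist_norm)
    then have "norm (?p (X x) t - ?p q t) < e" for t
      using norm_polygon_diff_le[of "X x" q "dist x (q j)"] that by (meson order_le_less_trans)
    then have "homotopic_loops S (?p q) (?p (X x))"
      using e(2) polygon_path[of "X x" N, OF perX N0] by blast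
    then have "admissible \<kappa> N (X x)"
      using hom homotopic_loops_trans perX unfolding admissible_def by blast
    from min[OF this] show ?thesis using act[of x] act[of "q j"] Xq by simp
  qed
  let ?X = "(q j - q (j - 1)) - (q (j + 1) - q j)
      + ((f (q j) - f (q (j - 1))) - (f (q (j + 1)) - f (q j))) *\<^sub>R G (q j)"
  let ?W = "?X /\<^sub>R h - (h * g) *\<^sub>R G (q j)"
  have "(\<lambda>u. ?W \<bullet> u) = (\<lambda>u. 0)"
  proof (rule has_derivative_local_min)
    show "(?\<phi> has_derivative (\<lambda>u. ?W \<bullet> u)) (at (q j))"
      by (rule cell_derivative) (use admissible_in[OF q N0] h in auto)
    show "\<forall>\<^sub>F x in at (q j). ?\<phi> (q j) \<le> ?\<phi> x"
      unfolding eventually_at using e(1) min\<phi> by blast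
  qed
  then have "?W \<bullet> ?W = 0" by metis
  then have "?W = 0" by simp
  then have W0: "?X /\<^sub>R h = (h * g) *\<^sub>R G (q j)" by simp
  have "?X = h *\<^sub>R (?X /\<^sub>R h)" using h by simp
  also have "\<dots> = h *\<^sub>R ((h * g) *\<^sub>R G (q j))" by (simp only: W0)
  also have "\<dots> = (h\<^sup>2 * g) *\<^sub>R G (q j)" by (simp add: power2_eq_square)
  finally show ?thesis .
qed

end

text \<open>Inverts I + G G^T, the mass matrix of the graph, on multiples of \<open>G\<close>
  (Sherman-Morrison): the inner product with \<open>G\<close> determines
  \<open>D \<bullet> G\<close>, and then \<open>D\<close> itself.\<close>

lemma solve_rank_one_perturbation:
  fixes D G :: "'a::real_inner"
  assumes "D + (D \<bullet> G) *\<^sub>R G = c *\<^sub>R G"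
  shows "D = (c / (1 + (norm G)\<^sup>2)) *\<^sub>R G"
proof -
  have pos: "1 + (norm G)\<^sup>2 > 0" by (simp add: add_pos_nonneg)
  have "D \<bullet> G + (D \<bullet> G) * (norm G)\<^sup>2 = c * (norm G)\<^sup>2"
    using arg_cong[OF assms, of "\<lambda>x. x \<bullet> G"] by (simp add: inner_add_left power2_norm_eq_inner)
  then have DG: "D \<bullet> G = c * (norm G)\<^sup>2 / (1 + (norm G)\<^sup>2)"
    using pos by (simp add: field_simps)
  have "D = (c - D \<bullet> G) *\<^sub>R G" using assms by (simp add: algebra_simps)
  also have "c - D \<bullet> G = c / (1 + (norm G)\<^sup>2)"
    unfolding DG using pos by (simp add: field_simps)
  finally show ?thesis .
qed

text \<open>The denominator absorbs the gradient, so the bounds on accelerations carry no bound on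
  \<open>G\<close>.\<close>

lemma norm_scaleR_div_one_plus_le:
  fixes G :: "'a::real_normed_vector"
  shows "norm ((c / (1 + (norm G)\<^sup>2)) *\<^sub>R G) \<le> \<bar>c\<bar>"
proof -
  have pos: "1 + (norm G)\<^sup>2 > 0" by (simp add: add_pos_nonneg)
  have "norm G \<le> 1 + (norm G)\<^sup>2"
    using zero_le_power2[of "norm G - 1 / 2"] by (simp add: power2_diff field_simps)
  then have "\<bar>c\<bar> * norm G \<le> \<bar>c\<bar> * (1 + (norm G)\<^sup>2)" by (intro mult_left_mono) auto
  then show ?thesis using pos by (simp add: field_simps abs_of_pos)
qed

section \<open>Velocity bounds and moduli of continuity\<close>

lemma sum_shift_periodic:
  fixes F :: "int \<Rightarrow> 'b::comm_monoid_add"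
  assumes "\<And>i. F (i + N) = F i" and "N > 0"
  shows "(\<Sum>i\<in>{0..<N}. F (i + 1)) = (\<Sum>i\<in>{0..<N}. F i)"
proof -
  have "(\<Sum>i\<in>{0..<N}. F (i + 1)) = (\<Sum>i\<in>{1..<1 + N}. F i)"
    by (rule sum.reindex_bij_witness[of _ "\<lambda>i. i - 1" "\<lambda>i. i + 1"]) auto
  then show ?thesis using sum_periodic_int[of F N 1] assms by simp
qed

text \<open>No Gronwall argument is needed, although the increments are quadratic in
  \<open>v\<close>: summed over a period, the quadratic terms are \<open>B\<close> times the energy.
  So the total variation of \<open>v\<close> is at most \<open>N * h * g + B * E\<close>, while at
  some index \<open>v\<close> does not exceed its root mean square.\<close>

lemma quadratic_increments_bound:
  fixes v :: "int \<Rightarrow> 'a::real_normed_vector"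
  assumes per: "\<And>i. v (i + N) = v i" and N: "N > 0" and h: "h > 0" and g: "g \<ge> 0" and B: "B \<ge> 0"
    and energy: "h * (\<Sum>i\<in>{0..<N}. (norm (v i))\<^sup>2) \<le> E"
    and inc: "\<And>i. norm (v (i + 1) - v i) \<le> h * (g + B * ((norm (v (i + 1)))\<^sup>2 + (norm (v i))\<^sup>2) / 2)"
  shows "norm (v i) \<le> sqrt (E / (of_int N * h)) + of_int N * h * g + B * E"
proof -
  have hN: "of_int N * h > 0" using N h by simp
  have "\<exists>j\<in>{0..<N}. (norm (v j))\<^sup>2 \<le> E / (of_int N * h)"
  proof (rule ccontr)
    assume "\<not> ?thesis"
    then have "E / (of_int N * h) < (norm (v j))\<^sup>2" if "j \<in> {0..<N}" for j
      using that by force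
    then have "(\<Sum>j\<in>{0..<N}. E / (of_int N * h)) < (\<Sum>j\<in>{0..<N}. (norm (v j))\<^sup>2)"
      using N by (intro sum_strict_mono) auto
    then have "h * (\<Sum>j\<in>{0..<N}. E / (of_int N * h)) < h * (\<Sum>j\<in>{0..<N}. (norm (v j))\<^sup>2)"
      using h by (rule mult_strict_left_mono)
    then show False using energy N h by simp
  qed
  then obtain j where j: "norm (v j) \<le> sqrt (E / (of_int N * h))"
    using real_le_rsqrt by blast
  have "norm (v i - v j) \<le> (\<Sum>l\<in>{0..<N}. norm (v (l + 1) - v l))"
    by (rule periodic_variation_le_sum[of v N, OF per N])
  also have "\<dots> \<le> (\<Sum>l\<in>{0..<N}. h * (g + B * ((norm (v (l + 1)))\<^sup>2 + (norm (v l))\<^sup>2) / 2))"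
    by (intro sum_mono inc)
  also have "\<dots> = of_int N * h * g
      + h * B / 2 * ((\<Sum>l\<in>{0..<N}. (norm (v (l + 1)))\<^sup>2) + (\<Sum>l\<in>{0..<N}. (norm (v l))\<^sup>2))"
    using N by (simp add: algebra_simps sum.distrib sum_distrib_left sum_divide_distrib add_divide_distrib)
  also have "(\<Sum>l\<in>{0..<N}. (norm (v (l + 1)))\<^sup>2) = (\<Sum>l\<in>{0..<N}. (norm (v l))\<^sup>2)"
    by (rule sum_shift_periodic) (use per N in auto)
  also have "of_int N * h * g + h * B / 2 * ((\<Sum>l\<in>{0..<N}. (norm (v l))\<^sup>2) + (\<Sum>l\<in>{0..<N}. (norm (v l))\<^sup>2))
      = of_int N * h * g + B * (h * (\<Sum>l\<in>{0..<N}. (norm (v l))\<^sup>2))"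
    by simp
  also have "\<dots> \<le> of_int N * h * g + B * E"
    using mult_left_mono[OF energy B] by simp
  finally show ?thesis
    using j norm_triangle_ineq[of "v i - v j" "v j"] by simp
qed

text \<open>Turns uniform continuity into an error sequence of the kind that
  \<open>euler_limit\<close> expects: the largest oscillation of \<open>\<phi>\<close> at scale
  \<open>s k\<close>.\<close>

lemma modulus_of_continuity:
  fixes \<phi> :: "'a::metric_space \<Rightarrow> real" and s :: "nat \<Rightarrow> real"
  assumes P: "compact P" and \<phi>: "continuous_on P \<phi>" and s: "s \<longlonglongrightarrow> 0"
  obtains \<epsilon> where "\<epsilon> \<longlonglongrightarrow> 0"
    "\<And>k p p'. p \<in> P \<Longrightarrow> p' \<in> P \<Longrightarrow> dist p p' \<le> s k \<Longrightarrow> \<bar>\<phi> p - \<phi> p'\<bar> \<le> \<epsilon> k"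
proof -
  obtain B where B: "\<And>x. x \<in> P \<Longrightarrow> \<bar>\<phi> x\<bar> \<le> B"
    using compact_imp_bounded[OF compact_continuous_image[OF \<phi> P]]
    by (auto simp: bounded_iff)
  \<comment> \<open>Inserting 0 makes the set nonempty and the supremum nonnegative.\<close>
  define A where "A k = insert 0 {\<bar>\<phi> p - \<phi> p'\<bar> | p p'. p \<in> P \<and> p' \<in> P \<and> dist p p' \<le> s k}" for k
  have bdd: "bdd_above (A k)" for k
  proof (rule bdd_aboveI)
    show "x \<le> max 0 (2 * B)" if x: "x \<in> A k" for x
    proof (cases "x = 0")
      case False
      then obtain p p' where p: "x = \<bar>\<phi> p - \<phi> p'\<bar>" "p \<in> P" "p' \<in> P"
        using x by (auto simp: A_def)
      then show ?thesis using abs_triangle_ineq4[of "\<phi> p" "\<phi> p'"] B[OF p(2)] B[OF p(3)] by simp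
    qed simp
  qed
  have A0: "0 \<in> A k" for k by (simp add: A_def)
  show ?thesis
  proof
    show "\<bar>\<phi> p - \<phi> p'\<bar> \<le> Sup (A k)" if "p \<in> P" "p' \<in> P" "dist p p' \<le> s k" for k p p'
      by (rule cSup_upper[OF _ bdd]) (use that in \<open>auto simp: A_def\<close>)
    show "(\<lambda>k. Sup (A k)) \<longlonglongrightarrow> 0"
    proof (rule tendstoI)
      fix e :: real assume e: "0 < e"
      obtain d where d: "d > 0" "\<And>p p'. p \<in> P \<Longrightarrow> p' \<in> P \<Longrightarrow> dist p' p < d \<Longrightarrow> dist (\<phi> p') (\<phi> p) < e / 2"
        using compact_uniformly_continuous[OF \<phi> P] e unfolding uniformly_continuous_on_def
        by (metis half_gt_zero)
      have "\<forall>\<^sub>F k in sequentially. s k < d" using order_tendstoD(2)[OF s d(1)] .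
      then show "\<forall>\<^sub>F k in sequentially. dist (Sup (A k)) 0 < e"
      proof eventually_elim
        case (elim k)
        have "Sup (A k) \<le> e / 2"
        proof (rule cSup_least)
          show "x \<le> e / 2" if x: "x \<in> A k" for x
          proof (cases "x = 0")
            case False
            then obtain p p' where "x = \<bar>\<phi> p - \<phi> p'\<bar>" "p \<in> P" "p' \<in> P" "dist p p' \<le> s k"
              using x by (auto simp: A_def)
            then show ?thesis using d(2)[of p' p] elim by (simp add: dist_real_def)
          qed (use e in simp)
        qed (use A0 in blast)
        moreover have "0 \<le> Sup (A k)" by (rule cSup_upper[OF A0 bdd])
        ultimately show ?case using e by simp
      qed
    qed
  qed
qed

lemma polygon_fst: "fst (polygon z x) = polygon (\<lambda>i. fst (z i)) x"
  by (simp add: polygon_def)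

section \<open>Taylor expansion of the surface and the discrete acceleration\<close>

context sliding_surface
begin

lemma DERIV_along_line:
  assumes "x + s *\<^sub>R u \<in> S"
  shows "((\<lambda>s. f (x + s *\<^sub>R u)) has_real_derivative u \<bullet> G (x + s *\<^sub>R u)) (at s)"
    and "((\<lambda>s. u \<bullet> G (x + s *\<^sub>R u)) has_real_derivative u \<bullet> H (x + s *\<^sub>R u) u) (at s)"
proof -
  have l: "((\<lambda>s. x + s *\<^sub>R u) has_derivative (\<lambda>d. d *\<^sub>R u)) (at s)"
    by (auto intro!: derivative_eq_intros)
  have "(f has_derivative (\<lambda>v. v \<bullet> G (x + s *\<^sub>R u))) (at (x + s *\<^sub>R u))"
    using grad_f[OF assms] by (simp add: gderiv_def)
  from has_derivative_compose[OF l this]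
  show "((\<lambda>s. f (x + s *\<^sub>R u)) has_real_derivative u \<bullet> G (x + s *\<^sub>R u)) (at s)"
    by (simp add: has_field_derivative_def mult.commute[of _ "u \<bullet> _"])
  have lin: "H (x + s *\<^sub>R u) (d *\<^sub>R u) = d *\<^sub>R H (x + s *\<^sub>R u) u" for d
    using has_derivative_linear[OF hess_f[OF assms]] by (rule linear_scale)
  have "((\<lambda>s. u \<bullet> G (x + s *\<^sub>R u)) has_derivative (\<lambda>d. u \<bullet> H (x + s *\<^sub>R u) (d *\<^sub>R u))) (at s)"
    by (rule has_derivative_inner_right) (rule has_derivative_compose[OF l hess_f[OF assms]])
  then show "((\<lambda>s. u \<bullet> G (x + s *\<^sub>R u)) has_real_derivative u \<bullet> H (x + s *\<^sub>R u) u) (at s)"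
    by (simp add: has_field_derivative_def lin mult.commute[of _ "u \<bullet> _"])
qed

text \<open>Lagrange remainder along a segment. Of the intermediate point only its distance from
  \<open>x\<close> is kept, which is what a modulus of continuity of the Hessian form
  requires.\<close>

lemma taylor2:
  assumes sub: "cball x \<rho> \<subseteq> S" and u: "norm u \<le> \<rho>"
  obtains y where "norm (y - x) \<le> norm u" "f (x + u) - f x = u \<bullet> G x + (u \<bullet> H y u) / 2"
proof -
  have inS: "x + s *\<^sub>R u \<in> S" if "0 \<le> s" "s \<le> 1" for s
  proof -
    have "norm (s *\<^sub>R u) \<le> \<rho>" using that u mult_left_le_one_le[of "norm u" s] by simp
    then show ?thesis using sub by (auto simp: dist_norm)
  qed
  \<comment> \<open>The successive derivatives of \<open>s \<mapsto> f (x + s *\<^sub>R u)\<close>,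
    indexed as \<open>Maclaurin2\<close> wants them.\<close>
  define d where "d m s = (if m = 0 then f (x + s *\<^sub>R u) else if m = 1 then u \<bullet> G (x + s *\<^sub>R u)
      else u \<bullet> H (x + s *\<^sub>R u) u)" for m :: nat and s
  have "\<exists>t. 0 < t \<and> t \<le> 1 \<and> f (x + 1 *\<^sub>R u) = (\<Sum>m<2. d m 0 / fact m * 1 ^ m) + d 2 t / fact 2 * 1 ^ 2"
  proof (rule Maclaurin2)
    show "d 0 = (\<lambda>s. f (x + s *\<^sub>R u))" by (simp add: d_def fun_eq_iff)
    show "\<forall>m t. m < 2 \<and> 0 \<le> t \<and> t \<le> 1 \<longrightarrow> (d m has_real_derivative d (Suc m) t) (at t)"
    proof (intro allI impI, elim conjE)
      fix m :: nat and t :: real assume "m < 2" "0 \<le> t" "t \<le> 1"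
      then consider "m = 0" | "m = 1" by linarith
      then show "(d m has_real_derivative d (Suc m) t) (at t)"
        using DERIV_along_line[OF inS[OF \<open>0 \<le> t\<close> \<open>t \<le> 1\<close>]] by cases (auto simp: d_def[abs_def])
    qed
  qed simp
  then obtain t where t: "0 < t" "t \<le> 1" "f (x + u) = f x + u \<bullet> G x + (u \<bullet> H (x + t *\<^sub>R u) u) / 2"
    by (auto simp: d_def numeral_2_eq_2)
  show ?thesis
  proof
    show "norm ((x + t *\<^sub>R u) - x) \<le> norm u"
      using t mult_left_le_one_le[of "norm u" t] by simp
    show "f (x + u) - f x = u \<bullet> G x + (u \<bullet> H (x + t *\<^sub>R u) u) / 2" using t(3) by simp
  qed
qed

lemma hess_bound:
  assumes K: "compact K" "K \<subseteq> S"
  obtains B where "B \<ge> 0" "\<And>x u. x \<in> K \<Longrightarrow> norm (H x u) \<le> B * norm u"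
proof -
  have "compact ((\<lambda>(q, u). H q u) ` (K \<times> sphere 0 1))"
    by (rule compact_continuous_image)
       (use K in \<open>auto intro!: compact_Times continuous_on_subset[OF cont_hess]\<close>)
  from compact_imp_bounded[OF this] obtain b where
    b: "\<And>x u. x \<in> K \<Longrightarrow> norm u = 1 \<Longrightarrow> norm (H x u) \<le> b"
    by (force simp: bounded_iff)
  have "norm (H x u) \<le> max b 0 * norm u" if x: "x \<in> K" for x u
  proof (cases "u = 0")
    case True
    then show ?thesis
      using linear_0[OF has_derivative_linear[OF hess_f[of x]]] x K by auto
  next
    case False
    have "H x u = norm u *\<^sub>R H x (u /\<^sub>R norm u)"
      using linear_scale[OF has_derivative_linear[OF hess_f[of x]], of "norm u" "u /\<^sub>R norm u"] x K False
      by auto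
    moreover have "norm (H x (u /\<^sub>R norm u)) \<le> max b 0" using b[OF x, of "u /\<^sub>R norm u"] False by simp
    ultimately show ?thesis
      using mult_left_mono[of "norm (H x (u /\<^sub>R norm u))" "max b 0" "norm u"] by (simp add: mult.commute)
  qed
  then show ?thesis using that[of "max b 0"] by simp
qed

text \<open>Along a curve, the second derivative of f is
  \<open>a \<bullet> G q + v \<bullet> H q v\<close>. The equation of motion \<open>a + (a \<bullet>
  G q + v \<bullet> H q v) *\<^sub>R G q = - g *\<^sub>R G q\<close> is solved here for
  \<open>a\<close> by inverting I + G G^T.\<close>

definition acc :: "'a \<Rightarrow> 'a \<Rightarrow> 'a" where
  "acc q v = (- (g + v \<bullet> H q v) / (1 + (norm (G q))\<^sup>2)) *\<^sub>R G q"

lemma continuous_on_hess_quadratic: "continuous_on (S \<times> UNIV) (\<lambda>(q, v). v \<bullet> H q v)"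
  using continuous_on_inner[OF continuous_on_snd[OF continuous_on_id] cont_hess]
  by (simp add: case_prod_unfold)

lemma continuous_on_acc: "continuous_on (S \<times> UNIV) (\<lambda>(q, v). acc q v)"
proof -
  have "continuous_on S G"
    using hess_f has_derivative_continuous continuous_at_imp_continuous_on by blast
  then have G: "continuous_on (S \<times> UNIV) (\<lambda>z. G (fst z))"
    by (rule continuous_on_compose2) (auto intro: continuous_intros)
  have "1 + (norm (G (fst z)))\<^sup>2 \<noteq> 0" for z :: "'a \<times> 'a"
    by (metis add_pos_nonneg less_numeral_extra(1) less_numeral_extra(3) zero_le_power2)
  moreover have "continuous_on (S \<times> UNIV) (\<lambda>z. snd z \<bullet> H (fst z) (snd z))"
    using continuous_on_hess_quadratic by (simp add: case_prod_unfold)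
  ultimately show ?thesis
    unfolding acc_def case_prod_unfold using G
    by (intro continuous_on_scaleR continuous_on_divide continuous_on_minus continuous_on_add
        continuous_on_const continuous_on_power continuous_on_norm ballI)
qed

text \<open>\<open>f\<close> is expanded about \<open>q j\<close> forwards to
  \<open>q (j + 1)\<close> and backwards to \<open>q (j - 1)\<close>. The linear terms combine to
  the velocity increment paired with \<open>G\<close>, the quadratic ones to a mean of two Hessian
  terms. The result is an exact identity of the same form as \<open>acc\<close>, with the Hessian
  taken at nearby points.\<close>

lemma discrete_acceleration:
  fixes q :: "int \<Rightarrow> 'a" and h :: real
  defines "v i \<equiv> (q i - q (i - 1)) /\<^sub>R h"
  assumes h: "h > 0" and sub: "cball (q j) \<rho> \<subseteq> S" and step: "\<And>i. norm (q (i + 1) - q i) \<le> \<rho>"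
    and el: "(q j - q (j - 1)) - (q (j + 1) - q j)
      + ((f (q j) - f (q (j - 1))) - (f (q (j + 1)) - f (q j))) *\<^sub>R G (q j) = (h\<^sup>2 * g) *\<^sub>R G (q j)"
  obtains y y' where "norm (y - q j) \<le> h * norm (v (j + 1))" "norm (y' - q j) \<le> h * norm (v j)"
    "v (j + 1) - v j = (- (h * (g + (v (j + 1) \<bullet> H y (v (j + 1)) + v j \<bullet> H y' (v j)) / 2))
       / (1 + (norm (G (q j)))\<^sup>2)) *\<^sub>R G (q j)"
proof -
  define u where "u = v (j + 1)"
  define w where "w = v j"
  have hu: "h *\<^sub>R u = q (j + 1) - q j" using h by (simp add: v_def u_def)
  have hw: "h *\<^sub>R w = q j - q (j - 1)" using h by (simp add: v_def w_def)
  have nu: "norm (h *\<^sub>R u) \<le> \<rho>" using step[of j] by (simp add: hu)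
  have nw: "norm (- (h *\<^sub>R w)) \<le> \<rho>" using step[of "j - 1"] by (simp add: hw norm_minus_commute)
  from taylor2[OF sub nu] obtain y where y: "norm (y - q j) \<le> norm (h *\<^sub>R u)"
    "f (q j + h *\<^sub>R u) - f (q j) = h *\<^sub>R u \<bullet> G (q j) + (h *\<^sub>R u \<bullet> H y (h *\<^sub>R u)) / 2"
    by blast
  from taylor2[OF sub nw] obtain y' where y': "norm (y' - q j) \<le> norm (- (h *\<^sub>R w))"
    "f (q j + - (h *\<^sub>R w)) - f (q j) = - (h *\<^sub>R w) \<bullet> G (q j) + (- (h *\<^sub>R w) \<bullet> H y' (- (h *\<^sub>R w))) / 2"
    by blast
  have yS: "y \<in> S" "y' \<in> S"
    using sub y(1) y'(1) nu nw by (auto simp: dist_norm norm_minus_commute)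
  have lin: "H y (h *\<^sub>R u) = h *\<^sub>R H y u" "H y' (- (h *\<^sub>R w)) = - (h *\<^sub>R H y' w)"
    using has_derivative_linear[OF hess_f[OF yS(1)]] has_derivative_linear[OF hess_f[OF yS(2)]]
    by (simp_all add: linear_scale linear_neg)
  let ?E = "(u \<bullet> H y u + w \<bullet> H y' w) / 2"
  have f1: "f (q (j + 1)) - f (q j) = h * (u \<bullet> G (q j)) + h\<^sup>2 * (u \<bullet> H y u) / 2"
    using y(2) by (simp add: hu[symmetric] lin power2_eq_square) (simp add: hu)
  have f2: "f (q j) - f (q (j - 1)) = h * (w \<bullet> G (q j)) - h\<^sup>2 * (w \<bullet> H y' w) / 2"
  proof -
    have "q j + - (h *\<^sub>R w) = q (j - 1)" by (simp add: hw)
    then show ?thesis using y'(2) by (simp add: lin power2_eq_square)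
  qed
  have "h *\<^sub>R w - h *\<^sub>R u + ((h * (w \<bullet> G (q j)) - h\<^sup>2 * (w \<bullet> H y' w) / 2)
      - (h * (u \<bullet> G (q j)) + h\<^sup>2 * (u \<bullet> H y u) / 2)) *\<^sub>R G (q j) = (h\<^sup>2 * g) *\<^sub>R G (q j)"
    using el by (simp only: f1 f2 hu hw)
  \<comment> \<open>A common factor \<open>- h\<close> is taken out; what remains has the shape
    required by \<open>solve_rank_one_perturbation\<close>.\<close>
  then have "(- h) *\<^sub>R ((u - w) + ((u - w) \<bullet> G (q j)) *\<^sub>R G (q j))
      = (- h) *\<^sub>R ((- (h * (g + ?E))) *\<^sub>R G (q j))"
    by (simp add: algebra_simps power2_eq_square inner_diff_left add_divide_distrib)
  moreover have "- h \<noteq> 0" using h by simp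
  ultimately have "(u - w) + ((u - w) \<bullet> G (q j)) *\<^sub>R G (q j) = (- (h * (g + ?E))) *\<^sub>R G (q j)"
    using scaleR_left_imp_eq by blast
  from solve_rank_one_perturbation[OF this]
  show ?thesis
    using that[of y y'] y(1) y'(1) h unfolding u_def w_def by simp
qed

end

section \<open>Sampling a smooth loop\<close>

lemma lipschitz_on_unit_interval:
  fixes p :: "real \<Rightarrow> 'a::real_normed_vector"
  assumes der: "\<And>t. t \<in> {0..1} \<Longrightarrow> (p has_vector_derivative p' t) (at t)"
    and cont: "continuous_on {0..1} p'"
  obtains L where "L \<ge> 0" "\<And>s t. s \<in> {0..1} \<Longrightarrow> t \<in> {0..1} \<Longrightarrow> norm (p t - p s) \<le> L * \<bar>t - s\<bar>"
proof -
  obtain L where L: "\<And>t. t \<in> {0..1} \<Longrightarrow> norm (p' t) \<le> L"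
    using compact_imp_bounded[OF compact_continuous_image[OF cont]] unfolding bounded_iff by blast
  have "norm (p t - p s) \<le> L * norm (t - s)" if "s \<in> {0..1}" "t \<in> {0..1}" for s t
  proof (rule differentiable_bound[of "{0..1}" p "\<lambda>t d. d *\<^sub>R p' t"])
    fix t :: real assume t: "t \<in> {0..1}"
    show "(p has_derivative (\<lambda>d. d *\<^sub>R p' t)) (at t within {0..1})"
      using der[OF t] has_derivative_at_withinI unfolding has_vector_derivative_def by blast
    show "onorm (\<lambda>d. d *\<^sub>R p' t) \<le> L"
    proof (rule onorm_le)
      fix d :: real
      have "\<bar>d\<bar> * norm (p' t) \<le> \<bar>d\<bar> * L" by (intro mult_left_mono L t) simp
      then show "norm (d *\<^sub>R p' t) \<le> L * norm d" by (simp add: mult.commute)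
    qed
  qed (use that in auto)
  moreover have "L \<ge> 0" using order_trans[OF norm_ge_zero L[of 0]] by simp
  ultimately show ?thesis using that by simp
qed

text \<open>The factor 2 counts the distance from the polygon to its vertex and from that vertex to
  the curve. The codomain is general because the estimate is needed both for a loop and for
  \<open>f\<close> along it.\<close>

lemma polygon_sampling:
  fixes p :: "real \<Rightarrow> 'a::real_normed_vector"
  assumes loop: "p 1 = p 0" and N: "N > 0"
    and L: "\<And>s t. s \<in> {0..1} \<Longrightarrow> t \<in> {0..1} \<Longrightarrow> norm (p t - p s) \<le> L * \<bar>t - s\<bar>"
  defines "q \<equiv> \<lambda>i. p (of_int (i mod N) / of_int N)"
  shows "norm (q (i + 1) - q i) \<le> L / of_int N"
    and "t \<in> {0..1} \<Longrightarrow> norm (polygon q (of_int N * t) - p t) \<le> 2 * (L / of_int N)"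
proof -
  have step: "norm (q (i + 1) - q i) \<le> L / of_int N" for i
  proof -
    define m where "m = i mod N"
    have m: "0 \<le> m" "m < N" using N by (simp_all add: m_def)
    have "(i + 1) mod N = (m + 1) mod N" by (simp add: m_def mod_add_left_eq)
    then have q1: "q (i + 1) = p (of_int (m + 1) / of_int N)"
      using m loop N by (cases "m + 1 = N") (auto simp: q_def)
    have "norm (p (of_int (m + 1) / of_int N) - p (of_int m / of_int N))
        \<le> L * \<bar>of_int (m + 1) / of_int N - of_int m / of_int N\<bar>"
      by (rule L) (use m N in auto)
    also have "\<bar>of_int (m + 1) / of_int N - of_int m / of_int N\<bar> = 1 / (of_int N :: real)"
      using N by (simp add: field_simps)
    finally show ?thesis unfolding q1 by (simp add: q_def m_def)
  qed
  then show "norm (q (i + 1) - q i) \<le> L / of_int N" .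
  show "norm (polygon q (of_int N * t) - p t) \<le> 2 * (L / of_int N)" if t: "t \<in> {0..1}"
  proof -
    define l where "l = \<lfloor>of_int N * t\<rfloor>"
    have l: "of_int l \<le> of_int N * t" "of_int N * t < of_int l + 1" by (simp_all add: l_def)
    have l0: "0 \<le> l" using t N by (simp add: l_def)
    have "of_int N * t \<le> of_int N" using t N by simp
    then have lN: "l \<le> N" using l(1) by linarith
    have ql: "q l = p (of_int l / of_int N)"
      using l0 lN loop N by (cases "l = N") (auto simp: q_def)
    have "norm (p (of_int l / of_int N) - p t) \<le> L * \<bar>of_int l / of_int N - t\<bar>"
      by (rule L) (use t l0 lN N in auto)
    also have "\<dots> \<le> L * (1 / of_int N)"
    proof (rule mult_left_mono)
      show "\<bar>of_int l / of_int N - t\<bar> \<le> 1 / of_int N"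
      proof -
        have "of_int l / of_int N - t = (of_int l - of_int N * t) / of_int N"
          using N by (simp add: field_simps)
        moreover have "\<bar>of_int l - of_int N * t\<bar> \<le> 1" using l by linarith
        ultimately show ?thesis using N by (simp add: divide_right_mono)
      qed
      show "L \<ge> 0" using order_trans[OF norm_ge_zero L[of 0 1]] by simp
    qed
    finally have "norm (q l - p t) \<le> L / of_int N" by (simp add: ql)
    moreover have "norm (polygon q (of_int N * t) - q l) \<le> L / of_int N"
      unfolding l_def by (rule polygon_minus_vertex_le) (rule step)
    ultimately show ?thesis
      using norm_triangle_ineq[of "polygon q (of_int N * t) - q l" "q l - p t"] by simp
  qed
qed

context sliding_surface
begin

text \<open>The reflexive instance of \<open>homotopic_loops\<close> says that
  \<open>\<kappa>\<close> is a loop in \<open>S\<close>. Being only continuous, it may have no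
  finite action; it is replaced by a homotopic polynomial loop, along which position and
  \<open>f\<close> are Lipschitz, and this loop is sampled.\<close>

lemma comparison_polygons:
  assumes \<kappa>: "homotopic_loops S \<kappa> \<kappa>" and \<omega>: "\<omega> > 0"
  obtains c N1 where "N1 > 0"
    "\<And>N. N \<ge> N1 \<Longrightarrow> \<exists>q. admissible \<kappa> N q \<and> action (\<omega> / of_int N) N q \<le> c"
proof -
  have \<kappa>p: "path \<kappa>" "path_image \<kappa> \<subseteq> S" "pathfinish \<kappa> = pathstart \<kappa>"
    using \<kappa> by (simp_all add: homotopic_loops_refl)
  obtain e where e: "e > 0" "\<And>p. path p \<Longrightarrow> pathfinish p = pathstart p \<Longrightarrow>
      (\<forall>t\<in>{0..1}. norm (p t - \<kappa> t) < e) \<Longrightarrow> homotopic_loops S \<kappa> p"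
    using homotopic_nearby_loops[OF \<kappa>p(1) open_S \<kappa>p(2,3)] by blast
  obtain p where p: "polynomial_function p" "pathstart p = pathstart \<kappa>" "pathfinish p = pathfinish \<kappa>"
    "\<And>t. t \<in> {0..1} \<Longrightarrow> norm (p t - \<kappa> t) < e"
    using path_approx_polynomial_function[OF \<kappa>p(1) e(1)] by blast
  have hom: "homotopic_loops S \<kappa> p"
    by (rule e(2)) (use p \<kappa>p(3) path_polynomial_function in auto)
  have pS: "p t \<in> S" if "t \<in> {0..1}" for t
    using homotopic_loops_imp_subset[OF hom] that by (auto simp: path_image_def)
  have loop: "p 1 = p 0" using p \<kappa>p(3) by (simp add: pathstart_def pathfinish_def)
  have pp: "path p" using p(1) by (rule path_polynomial_function)
  obtain e' where e': "e' > 0" "\<And>r. path r \<Longrightarrow> pathfinish r = pathstart r \<Longrightarrow>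
      (\<forall>t\<in>{0..1}. norm (r t - p t) < e') \<Longrightarrow> homotopic_loops S p r"
    using homotopic_nearby_loops[OF pp open_S] homotopic_loops_imp_subset[OF hom]
      homotopic_loops_imp_loop[OF hom] by blast
  obtain p' where p': "polynomial_function p'" "\<And>t. (p has_vector_derivative p' t) (at t)"
    using has_vector_derivative_polynomial_function[OF p(1)] by blast
  have cp: "continuous_on {0..1} p" "continuous_on {0..1} p'"
    using p(1) p'(1) continuous_on_polymonial_function by blast+
  obtain L where L: "L \<ge> 0" "\<And>s t. s \<in> {0..1} \<Longrightarrow> t \<in> {0..1} \<Longrightarrow> norm (p t - p s) \<le> L * \<bar>t - s\<bar>"
    using lipschitz_on_unit_interval[OF p'(2) cp(2)] by blast
  have "continuous_on S G"
    using hess_f has_derivative_continuous continuous_at_imp_continuous_on by blast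
  then have cG: "continuous_on {0..1} (\<lambda>t. p' t \<bullet> G (p t))"
    using pS by (intro continuous_intros cp continuous_on_compose2[OF _ cp(1)]) auto
  have der: "((\<lambda>t. f (p t)) has_vector_derivative p' t \<bullet> G (p t)) (at t)" if "t \<in> {0..1}" for t
  proof -
    have "(f has_derivative (\<lambda>v. v \<bullet> G (p t))) (at (p t))"
      using grad_f[OF pS[OF that]] by (simp add: gderiv_def)
    from has_derivative_compose[OF p'(2)[of t, unfolded has_vector_derivative_def] this]
    show ?thesis by (simp add: has_vector_derivative_def)
  qed
  obtain M where "M \<ge> 0" and
    M: "\<And>s t. s \<in> {0..1} \<Longrightarrow> t \<in> {0..1} \<Longrightarrow> norm (f (p t) - f (p s)) \<le> M * \<bar>t - s\<bar>"
    using lipschitz_on_unit_interval[OF der cG] by metis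
  have "continuous_on {0..1} (\<lambda>t. f (p t))"
    using pS by (intro continuous_on_compose2[OF _ cp(1), of S]
        continuous_at_imp_continuous_on ballI f_isCont) auto
  then obtain C where C: "\<And>t. t \<in> {0..1} \<Longrightarrow> norm (f (p t)) \<le> C"
    using compact_imp_bounded[OF compact_continuous_image[of "{0..1}" "\<lambda>t. f (p t)"]]
    unfolding bounded_iff by blast
  obtain N1 where N1: "2 * L / e' < real N1" using reals_Archimedean2 by blast
  show ?thesis
  proof
    show "int (Suc N1) > 0" by simp
    fix N :: int assume "N \<ge> int (Suc N1)"
    then have N: "N > 0" and NL: "2 * L / e' < of_int N" using N1 by linarith+
    define q where "q i = p (of_int (i mod N) / of_int N)" for i
    define h where "h = \<omega> / of_int N"
    have h: "h > 0" using \<omega> N by (simp add: h_def)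
    have per: "q (i + N) = q i" for i by (simp add: q_def)
    have near: "norm (polygon q (of_int N * t) - p t) < e'" if "t \<in> {0..1}" for t
    proof -
      have "2 * (L / of_int N) < e'" using NL N e'(1) by (simp add: field_simps)
      then show ?thesis
        using polygon_sampling(2)[of p N L t, OF loop N L(2) that] unfolding q_def by linarith
    qed
    have "homotopic_loops S p (\<lambda>s. polygon q (of_int N * s))"
      by (intro e'(2) polygon_path[of q N, OF per N] ballI near)
    then have adm: "admissible \<kappa> N q"
      using hom per homotopic_loops_trans unfolding admissible_def by blast
    have in01: "of_int (i mod N) / of_int N \<in> {0..1::real}" for i
      using N pos_mod_bound[of N i] by (simp add: less_imp_le del: pos_mod_bound)
    have cell: "cell h (q i) (q (i + 1)) \<le> ((L / of_int N)\<^sup>2 + (M / of_int N)\<^sup>2) / (2 * h) + h * g * C" for i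
    proof -
      have "(norm (q (i + 1) - q i))\<^sup>2 \<le> (L / of_int N)\<^sup>2"
        using polygon_sampling(1)[of p N L i, OF loop N L(2)] unfolding q_def by (intro power_mono) auto
      moreover have "norm (f (q (i + 1)) - f (q i)) \<le> M / of_int N"
        using polygon_sampling(1)[of "\<lambda>t. f (p t)" N M i, OF _ N M] loop unfolding q_def by simp
      then have "(f (q (i + 1)) - f (q i))\<^sup>2 \<le> (M / of_int N)\<^sup>2"
        by (metis norm_ge_zero power2_abs power_mono real_norm_def)
      ultimately have "((norm (q (i + 1) - q i))\<^sup>2 + (f (q (i + 1)) - f (q i))\<^sup>2) / (2 * h)
          \<le> ((L / of_int N)\<^sup>2 + (M / of_int N)\<^sup>2) / (2 * h)"
        using h by (intro divide_right_mono add_mono) auto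
      moreover have "h * g * (- f (q i)) \<le> h * g * C"
        using C[OF in01[of i]] h g_pos unfolding q_def by (intro mult_left_mono) auto
      ultimately show ?thesis unfolding cell_def by simp
    qed
    have "action h N q \<le> (\<Sum>i\<in>{0..<N}. ((L / of_int N)\<^sup>2 + (M / of_int N)\<^sup>2) / (2 * h) + h * g * C)"
      unfolding action_def by (intro sum_mono cell)
    \<comment> \<open>A kinetic cell is of order \<open>1 / N\<^sup>2\<close> divided by
      \<open>h = \<omega> / N\<close>, so the sum of \<open>N\<close> cells no longer depends on
      \<open>N\<close>.\<close>
    also have "\<dots> = (L\<^sup>2 + M\<^sup>2) / (2 * \<omega>) + \<omega> * g * C"
      using N \<omega> by (simp add: h_def field_simps power2_eq_square)
    finally show "\<exists>q. admissible \<kappa> N q \<and> action (\<omega> / of_int N) N q \<le> (L\<^sup>2 + M\<^sup>2) / (2 * \<omega>) + \<omega> * g * C"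
      using adm unfolding h_def by blast
  qed
qed

end

section \<open>Bounds uniform in the mesh\<close>

context sliding_surface
begin

text \<open>The order of choices matters: the action bound \<open>c\<close> first, then the distance
  \<open>\<delta>\<close> to the complement of \<open>S\<close>, and only then meshes fine enough
  for this \<open>\<delta>\<close>.\<close>

theorem minimizers_with_uniform_bounds:
  assumes \<kappa>: "homotopic_loops S \<kappa> \<kappa>" and null: "\<And>a. \<not> homotopic_loops S \<kappa> (\<lambda>_. a)" and \<omega>: "\<omega> > 0"
  obtains N q c \<delta> K where
    "\<And>k. N k \<ge> (2::int)" "(\<lambda>k. \<omega> / of_int (N k)) \<longlonglongrightarrow> 0" "\<delta> > 0" "compact K" "K \<subseteq> S"
    "\<And>k. admissible \<kappa> (N k) (q k)"
    "\<And>k. action (\<omega> / of_int (N k)) (N k) (q k) \<le> c"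
    "\<And>k q'. admissible \<kappa> (N k) q' \<Longrightarrow>
      action (\<omega> / of_int (N k)) (N k) (q k) \<le> action (\<omega> / of_int (N k)) (N k) q'"
    "\<And>k i. ball (q k i) \<delta> \<subseteq> S" "\<And>k i. cball (q k i) (\<delta> / 2) \<subseteq> K"
    "\<And>k i. norm (q k (i + 1) - q k i) \<le> \<delta> / 2"
proof -
  obtain c N1 where N1: "N1 > 0" and
    comp: "\<And>N. N \<ge> N1 \<Longrightarrow> \<exists>q. admissible \<kappa> N q \<and> action (\<omega> / of_int N) N q \<le> c"
    using comparison_polygons[OF \<kappa> \<omega>] by metis
  \<comment> \<open>The lower bound for \<open>f\<close> from \<open>action_bounds\<close>, with
    \<open>N * h\<close> replaced by \<open>\<omega>\<close>.\<close>
  define C where "C = c / (g * \<omega>) + sqrt (2 * \<omega> * c)"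
  obtain \<delta> where \<delta>: "\<delta> > 0" "\<And>x. x \<in> S \<Longrightarrow> - C \<le> f x \<Longrightarrow> ball x \<delta> \<subseteq> S"
    using barrier[of C] by blast
  obtain R where R: "- S \<subseteq> cball 0 R"
    using bounded_S unfolding bounded_iff by (meson mem_cball_0 subsetI)
  \<comment> \<open>Equivalent to \<open>2 * h * c \<le> (\<delta> / 2)\<^sup>2\<close> for
    \<open>h = \<omega> / N\<close> once \<open>N\<close> is at least \<open>N2\<close>; this makes
    the edges at most \<open>\<delta> / 2\<close>.\<close>
  obtain N2 where N2: "8 * \<omega> * c / \<delta>\<^sup>2 < real N2" using reals_Archimedean2 by blast
  define N where "N k = int k + (N1 + int N2 + 2)" for k
  define h where "h k = \<omega> / of_int (N k)" for k
  have N: "N k \<ge> 2" "N k \<ge> N1" "N k > 0" for k using N1 by (auto simp: N_def)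
  have h: "h k > 0" for k using \<omega> N(3)[of k] by (simp add: h_def)
  have Nh: "of_int (N k) * h k = \<omega>" for k using N(3)[of k] by (simp add: h_def)
  have Nhc: "of_int (N k) * (2 * h k * c) = 2 * \<omega> * c" for k
    using Nh[of k] by (metis mult.assoc mult.left_commute)
  have small: "2 * h k * c \<le> (\<delta> / 2)\<^sup>2" for k
  proof -
    have "real N2 \<le> of_int (N k)" using N1 by (simp add: N_def)
    then have "8 * \<omega> * c / \<delta>\<^sup>2 \<le> of_int (N k)" using N2 by linarith
    then have "8 * \<omega> * c \<le> \<delta>\<^sup>2 * of_int (N k)" using \<delta>(1) by (simp add: field_simps)
    then show ?thesis using N(3)[of k] by (simp add: h_def field_simps power2_eq_square)
  qed
  have "\<exists>q. admissible \<kappa> (N k) q \<and> action (h k) (N k) q \<le> c \<and>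
      (\<forall>q'. admissible \<kappa> (N k) q' \<longrightarrow> action (h k) (N k) q \<le> action (h k) (N k) q')" for k
  proof -
    obtain q0 where "admissible \<kappa> (N k) q0" "action (h k) (N k) q0 \<le> c"
      using comp[OF N(2)[of k]] unfolding h_def by blast
    from this N(3) h null \<delta>(1) _ small show ?thesis
    proof (rule minimizer_exists)
      show "ball x \<delta> \<subseteq> S" if "x \<in> S"
        "- (c / (g * (of_int (N k) * h k)) + sqrt (of_int (N k) * (2 * h k * c))) \<le> f x" for x
        using \<delta>(2)[OF that(1)] that(2) unfolding C_def Nh Nhc by blast
    qed blast
  qed
  then obtain q where q: "\<And>k. admissible \<kappa> (N k) (q k)" "\<And>k. action (h k) (N k) (q k) \<le> c"
    "\<And>k q'. admissible \<kappa> (N k) q' \<Longrightarrow> action (h k) (N k) (q k) \<le> action (h k) (N k) q'"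
    by metis
  note bnd = action_bounds[OF q(1) N(3) h q(2), unfolded Nh Nhc]
  have ball: "ball (q k i) \<delta> \<subseteq> S" for k i
    by (rule \<delta>(2)) (use admissible_in[OF q(1) N(3)] bnd(5) in \<open>auto simp: C_def\<close>)
  have step: "norm (q k (i + 1) - q k i) \<le> \<delta> / 2" for k i
    using order_trans[OF bnd(3) small] \<delta>(1) by (simp add: abs_le_square_iff[symmetric])
  define R' where "R' = R + 2 * sqrt (2 * \<omega> * c) + \<delta> / 2"
  have nq: "norm (q k i) \<le> R + 2 * sqrt (2 * \<omega> * c)" for k i
    by (rule admissible_bounded[OF q(1) N(3) null bnd(4) R])
  \<comment> \<open>Points of bounded norm at distance at least \<open>\<delta> / 2\<close> from the
    complement of \<open>S\<close>. Balls of radius \<open>\<delta> / 2\<close> about the vertices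
    fit in, so the intermediate points of Taylor's formula lie in \<open>K\<close> too.\<close>
  define K where "K = cball 0 R' \<inter> (\<Inter>z\<in>- S. {x. \<delta> / 2 \<le> dist x z})"
  have "closed (\<Inter>z\<in>- S. {x. \<delta> / 2 \<le> dist x z})"
    by (intro closed_INT ballI closed_Collect_le continuous_intros)
  then have K: "compact K" unfolding K_def by (intro compact_Int_closed compact_cball)
  have KS: "K \<subseteq> S"
  proof
    fix x assume "x \<in> K"
    then show "x \<in> S" using \<delta>(1) by (force simp: K_def)
  qed
  have cb: "cball (q k i) (\<delta> / 2) \<subseteq> K" for k i
  proof
    fix x assume x: "x \<in> cball (q k i) (\<delta> / 2)"
    have "norm x \<le> R'"
      using x nq[of k i] norm_triangle_ineq[of "x - q k i" "q k i"]
      by (simp add: R'_def dist_norm norm_minus_commute)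
    moreover have "\<delta> / 2 \<le> dist x z" if "z \<notin> S" for z
    proof -
      have "\<delta> \<le> dist (q k i) z" using ball[of k i] that by force
      then show ?thesis using x dist_triangle[of "q k i" z x] by simp
    qed
    ultimately show "x \<in> K" by (auto simp: K_def)
  qed
  have "filterlim (\<lambda>k. of_int (N1 + int N2 + 2) + real k) at_top sequentially"
    by (rule filterlim_tendsto_add_at_top[OF tendsto_const filterlim_real_sequentially])
  then have "(\<lambda>k. \<omega> / (of_int (N1 + int N2 + 2) + real k)) \<longlonglongrightarrow> 0"
    by (intro tendsto_divide_0[OF tendsto_const] filterlim_at_top_imp_at_infinity)
  then have "(\<lambda>k. \<omega> / of_int (N k)) \<longlonglongrightarrow> 0"
    by (simp add: N_def add_ac)
  then show ?thesis
    using that[of N \<delta> K q c] N(1) \<delta>(1) K KS q ball cb step unfolding h_def by blast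
qed

text \<open>\<open>V\<close> is the bound of \<open>quadratic_increments_bound\<close> for the
  energy \<open>2 * c\<close>. The last claim is the consistency error of the scheme: it comes only
  from taking the Hessian form at neighbouring points and velocities.\<close>

lemma minimizer_velocity_bounds:
  fixes q :: "int \<Rightarrow> 'a" and h :: real
  defines "v i \<equiv> (q i - q (i - 1)) /\<^sub>R h"
  assumes q: "admissible \<kappa> N q" "action h N q \<le> c"
    "\<And>q'. admissible \<kappa> N q' \<Longrightarrow> action h N q \<le> action h N q'"
    and N: "N \<ge> 2" and h: "h > 0" and K: "K \<subseteq> S"
    and cb: "\<And>i. cball (q i) \<rho> \<subseteq> K" and step: "\<And>i. norm (q (i + 1) - q i) \<le> \<rho>"
    and B: "B \<ge> 0" "\<And>x u. x \<in> K \<Longrightarrow> norm (H x u) \<le> B * norm u"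
    and V: "V = sqrt (2 * c / (of_int N * h)) + of_int N * h * g + B * (2 * c)"
  shows "norm (v i) \<le> V"
    and "norm (v (i + 1) - v i) \<le> h * (g + B * V\<^sup>2)"
    and "\<exists>y\<in>K. \<exists>y'\<in>K. norm (y - q i) \<le> h * V \<and> norm (y' - q i) \<le> h * V \<and>
      norm (v (i + 1) - v i - h *\<^sub>R acc (q i) (v i))
        \<le> h * \<bar>(v (i + 1) \<bullet> H y (v (i + 1)) + v i \<bullet> H y' (v i)) / 2 - v i \<bullet> H (q i) (v i)\<bar>"
proof -
  have N0: "N > 0" using N by simp
  note per = admissible_periodic[OF q(1)]
  have perv: "v (i + N) = v i" for i
    using per[of i] per[of "i - 1"] by (simp add: v_def algebra_simps)
  have vq: "h * norm (v i) = norm (q i - q (i - 1))" for i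
    using h by (simp add: v_def)
  have quad: "\<bar>u \<bullet> H x u\<bar> \<le> B * (norm u)\<^sup>2" if "x \<in> K" for x u
  proof -
    have "\<bar>u \<bullet> H x u\<bar> \<le> norm u * norm (H x u)" by (rule Cauchy_Schwarz_ineq2)
    also have "\<dots> \<le> norm u * (B * norm u)" by (intro mult_left_mono B that) simp
    finally show ?thesis by (simp add: power2_eq_square mult_ac)
  qed
  have acceleration: "\<exists>y\<in>K. \<exists>y'\<in>K. norm (y - q j) \<le> h * norm (v (j + 1)) \<and> norm (y' - q j) \<le> h * norm (v j) \<and>
      v (j + 1) - v j = (- (h * (g + (v (j + 1) \<bullet> H y (v (j + 1)) + v j \<bullet> H y' (v j)) / 2))
       / (1 + (norm (G (q j)))\<^sup>2)) *\<^sub>R G (q j)" for j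
  proof -
    obtain y y' where y: "norm (y - q j) \<le> h * norm (v (j + 1))" "norm (y' - q j) \<le> h * norm (v j)"
      "v (j + 1) - v j = (- (h * (g + (v (j + 1) \<bullet> H y (v (j + 1)) + v j \<bullet> H y' (v j)) / 2))
       / (1 + (norm (G (q j)))\<^sup>2)) *\<^sub>R G (q j)"
      using discrete_acceleration[OF h order_trans[OF cb K] step
          minimizer_equation[OF q(1) N h q(3)], of j]
      unfolding v_def by blast
    have "norm (y - q j) \<le> \<rho>" "norm (y' - q j) \<le> \<rho>"
      using y(1,2) step[of j] step[of "j - 1"] by (simp_all add: vq)
    then have "y \<in> K" "y' \<in> K" using cb[of j] by (auto simp: dist_norm norm_minus_commute)
    then show ?thesis using y by blast
  qed
  have inc: "norm (v (j + 1) - v j) \<le> h * (g + B * ((norm (v (j + 1)))\<^sup>2 + (norm (v j))\<^sup>2) / 2)" for j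
  proof -
    obtain y y' where y: "y \<in> K" "y' \<in> K"
      "v (j + 1) - v j = (- (h * (g + (v (j + 1) \<bullet> H y (v (j + 1)) + v j \<bullet> H y' (v j)) / 2))
       / (1 + (norm (G (q j)))\<^sup>2)) *\<^sub>R G (q j)"
      using acceleration by blast
    have "norm (v (j + 1) - v j) \<le> h * \<bar>g + (v (j + 1) \<bullet> H y (v (j + 1)) + v j \<bullet> H y' (v j)) / 2\<bar>"
      unfolding y(3) by (rule order_trans[OF norm_scaleR_div_one_plus_le]) (use h in \<open>simp add: abs_mult\<close>)
    also have "\<dots> \<le> h * (g + B * ((norm (v (j + 1)))\<^sup>2 + (norm (v j))\<^sup>2) / 2)"
      using quad[OF y(1), of "v (j + 1)"] quad[OF y(2), of "v j"] h g_pos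
      by (intro mult_left_mono) (auto simp: abs_le_iff field_simps)
    finally show ?thesis .
  qed
  have energy: "h * (\<Sum>i\<in>{0..<N}. (norm (v i))\<^sup>2) \<le> 2 * c"
  proof -
    have "(\<Sum>i\<in>{0..<N}. (norm (v i))\<^sup>2) = (\<Sum>i\<in>{0..<N}. (norm (v (i + 1)))\<^sup>2)"
      by (rule sum_shift_periodic[symmetric]) (use perv N0 in auto)
    then have "h * (h * (\<Sum>i\<in>{0..<N}. (norm (v i))\<^sup>2)) = (\<Sum>i\<in>{0..<N}. (h * norm (v (i + 1)))\<^sup>2)"
      by (simp add: sum_distrib_left power2_eq_square mult_ac)
    also have "\<dots> = (\<Sum>i\<in>{0..<N}. (norm (q (i + 1) - q i))\<^sup>2)"
      by (simp add: vq)
    also have "\<dots> \<le> h * (2 * c)"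
      using action_bounds(2)[OF q(1) N0 h q(2)] by (simp add: mult_ac)
    finally show ?thesis using h by simp
  qed
  have vV: "norm (v i) \<le> V" for i
    unfolding V by (rule quadratic_increments_bound[of v N, OF perv N0 h less_imp_le[OF g_pos] B(1) energy inc])
  then show "norm (v i) \<le> V" .
  have V0: "V \<ge> 0" using vV[of 0] norm_ge_zero order_trans by blast
  show "norm (v (i + 1) - v i) \<le> h * (g + B * V\<^sup>2)"
  proof -
    have "(norm (v (i + 1)))\<^sup>2 + (norm (v i))\<^sup>2 \<le> V\<^sup>2 + V\<^sup>2"
      by (intro add_mono power_mono vV) auto
    then have "B * ((norm (v (i + 1)))\<^sup>2 + (norm (v i))\<^sup>2) \<le> B * (V\<^sup>2 + V\<^sup>2)"
      using B(1) by (rule mult_left_mono)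
    then have "h * (g + B * ((norm (v (i + 1)))\<^sup>2 + (norm (v i))\<^sup>2) / 2) \<le> h * (g + B * V\<^sup>2)"
      using h by (intro mult_left_mono) auto
    then show ?thesis using inc[of i] by linarith
  qed
  obtain y y' where y: "y \<in> K" "y' \<in> K" "norm (y - q i) \<le> h * norm (v (i + 1))" "norm (y' - q i) \<le> h * norm (v i)"
    "v (i + 1) - v i = (- (h * (g + (v (i + 1) \<bullet> H y (v (i + 1)) + v i \<bullet> H y' (v i)) / 2))
       / (1 + (norm (G (q i)))\<^sup>2)) *\<^sub>R G (q i)"
    using acceleration by blast
  let ?e = "(v (i + 1) \<bullet> H y (v (i + 1)) + v i \<bullet> H y' (v i)) / 2 - v i \<bullet> H (q i) (v i)"
  \<comment> \<open>Both accelerations are multiples of \<open>G (q i)\<close> with the same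
    denominator, so \<open>g\<close> cancels and only the Hessian terms differ.\<close>
  have "v (i + 1) - v i - h *\<^sub>R acc (q i) (v i) = (- (h * ?e) / (1 + (norm (G (q i)))\<^sup>2)) *\<^sub>R G (q i)"
    unfolding y(5) acc_def
    by (simp add: scaleR_diff_left[symmetric] diff_divide_distrib[symmetric] algebra_simps)
  then have "norm (v (i + 1) - v i - h *\<^sub>R acc (q i) (v i)) \<le> \<bar>- (h * ?e)\<bar>"
    by (simp only: norm_scaleR_div_one_plus_le)
  also have "\<dots> = h * \<bar>?e\<bar>" using h by (simp add: abs_mult)
  finally have "norm (v (i + 1) - v i - h *\<^sub>R acc (q i) (v i)) \<le> h * \<bar>?e\<bar>" .
  moreover have "norm (y - q i) \<le> h * V" "norm (y' - q i) \<le> h * V"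
    using y(3,4) mult_left_mono[OF vV[of "i + 1"], of h] mult_left_mono[OF vV[of i], of h] h by linarith+
  ultimately show "\<exists>y\<in>K. \<exists>y'\<in>K. norm (y - q i) \<le> h * V \<and> norm (y' - q i) \<le> h * V \<and>
      norm (v (i + 1) - v i - h *\<^sub>R acc (q i) (v i))
        \<le> h * \<bar>(v (i + 1) \<bullet> H y (v (i + 1)) + v i \<bullet> H y' (v i)) / 2 - v i \<bullet> H (q i) (v i)\<bar>"
    using y(1,2) by blast
qed

end

section \<open>Periodic solutions in a homotopy class\<close>

context sliding_surface
begin

text \<open>The second-order equation is treated as the first-order system for (position, velocity)
  on a compact set. Reflexivity of \<open>\<kappa>\<close> again states that it is a loop in
  \<open>S\<close>.\<close>

theorem periodic_solution_in_class:
  assumes \<kappa>: "homotopic_loops S \<kappa> \<kappa>" and null: "\<And>a. \<not> homotopic_loops S \<kappa> (\<lambda>_. a)" and \<omega>: "\<omega> > 0"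
  obtains Q V where "\<And>t. Q t \<in> S" "\<And>t. Q (t + \<omega>) = Q t"
    "\<And>t. (Q has_vector_derivative V t) (at t)"
    "\<And>t. (V has_vector_derivative acc (Q t) (V t)) (at t)"
    "homotopic_loops S \<kappa> (\<lambda>s. Q (\<omega> * s))"
proof (rule minimizers_with_uniform_bounds[OF assms])
  fix N :: "nat \<Rightarrow> int" and c q \<delta> K
  assume N: "\<And>k. N k \<ge> 2" and hlim: "(\<lambda>k. \<omega> / of_int (N k)) \<longlonglongrightarrow> 0"
    and \<delta>: "\<delta> > 0" and K: "compact K" "K \<subseteq> S"
    and adm: "\<And>k. admissible \<kappa> (N k) (q k)"
    and act: "\<And>k. action (\<omega> / of_int (N k)) (N k) (q k) \<le> c"
    and min: "\<And>k q'. admissible \<kappa> (N k) q' \<Longrightarrow>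
      action (\<omega> / of_int (N k)) (N k) (q k) \<le> action (\<omega> / of_int (N k)) (N k) q'"
    and ball: "\<And>k i. ball (q k i) \<delta> \<subseteq> S" and cb: "\<And>k i. cball (q k i) (\<delta> / 2) \<subseteq> K"
    and step: "\<And>k i. norm (q k (i + 1) - q k i) \<le> \<delta> / 2"
  define h where "h k = \<omega> / of_int (N k)" for k
  have N0: "N k > 0" for k using N[of k] by simp
  have h: "h k > 0" for k using \<omega> N0[of k] by (simp add: h_def)
  have Nh: "of_int (N k) * h k = \<omega>" for k using N0[of k] by (simp add: h_def)
  obtain B where B: "B \<ge> 0" "\<And>x u. x \<in> K \<Longrightarrow> norm (H x u) \<le> B * norm u"
    using hess_bound[OF K] by metis
  define V where "V = sqrt (2 * c / \<omega>) + \<omega> * g + B * (2 * c)"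
  define v where "v k i = (q k i - q k (i - 1)) /\<^sub>R h k" for k i
  have Vk: "V = sqrt (2 * c / (of_int (N k) * h k)) + of_int (N k) * h k * g + B * (2 * c)" for k
    by (simp only: Nh V_def)
  note vb = minimizer_velocity_bounds[OF adm act[folded h_def] min[folded h_def] N h K(2) cb step B
      Vk, folded v_def]
  define W where "W = g + B * V\<^sup>2"
  have V0: "V \<ge> 0" using vb(1)[of 0 0] norm_ge_zero order_trans by blast
  have W0: "W \<ge> 0" using g_pos B(1) by (simp add: W_def)
  have hl: "h \<longlonglongrightarrow> 0" using hlim by (simp add: h_def[abs_def])
  \<comment> \<open>Scale of the consistency error: the Taylor points lie within
    \<open>h * V\<close> of the vertex, and one velocity step has length at most
    \<open>h * W\<close>.\<close>
  then have sl: "(\<lambda>k. h k * (V + W)) \<longlonglongrightarrow> 0" by (rule tendsto_mult_left_zero)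
  define P where "P = K \<times> cball (0::'a) V"
  have P: "compact P" unfolding P_def by (intro compact_Times K compact_cball)
  have PS: "P \<subseteq> S \<times> UNIV" using K(2) by (auto simp: P_def)
  obtain \<epsilon> where \<epsilon>: "\<epsilon> \<longlonglongrightarrow> 0" and mod: "\<And>k p p'. p \<in> P \<Longrightarrow> p' \<in> P \<Longrightarrow> dist p p' \<le> h k * (V + W) \<Longrightarrow>
      \<bar>(case p of (x, u) \<Rightarrow> u \<bullet> H x u) - (case p' of (x, u) \<Rightarrow> u \<bullet> H x u)\<bar> \<le> \<epsilon> k"
    using modulus_of_continuity[OF P continuous_on_subset[OF continuous_on_hess_quadratic PS] sl] by metis
  have qK: "q k i \<in> K" for k i using cb[of k i] \<delta> by auto
  define z where "z k i = (q k i, v k i)" for k i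
  define \<Phi> where "\<Phi> = (\<lambda>(x, u). (u, acc x u))"
  have zP: "z k i \<in> P" for k i using vb(1)[of k i] qK by (simp add: z_def P_def)
  have acc_step: "norm (v k (i + 1) - v k i - h k *\<^sub>R acc (q k i) (v k i)) \<le> h k * \<epsilon> k" for k i
  proof -
    obtain y y' where y: "y \<in> K" "y' \<in> K" "norm (y - q k i) \<le> h k * V" "norm (y' - q k i) \<le> h k * V"
      "norm (v k (i + 1) - v k i - h k *\<^sub>R acc (q k i) (v k i))
        \<le> h k * \<bar>(v k (i + 1) \<bullet> H y (v k (i + 1)) + v k i \<bullet> H y' (v k i)) / 2 - v k i \<bullet> H (q k i) (v k i)\<bar>"
      using vb(3)[of k i] by blast
    have "dist (y, v k (i + 1)) (q k i, v k i) \<le> norm (y - q k i) + norm (v k (i + 1) - v k i)"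
      using norm_Pair_le[of "y - q k i" "v k (i + 1) - v k i"] by (simp add: dist_norm)
    also have "\<dots> \<le> h k * V + h k * W"
      unfolding W_def by (intro add_mono y(3) vb(2))
    finally have 1: "\<bar>v k (i + 1) \<bullet> H y (v k (i + 1)) - v k i \<bullet> H (q k i) (v k i)\<bar> \<le> \<epsilon> k"
      using mod[of "(y, v k (i + 1))" "(q k i, v k i)" k] y(1) qK vb(1)
      by (simp add: P_def distrib_left)
    have "dist (y', v k i) (q k i, v k i) \<le> h k * V"
      using norm_Pair_le[of "y' - q k i" "0::'a"] y(4) by (simp add: dist_norm)
    also have "\<dots> \<le> h k * (V + W)" using h[of k] W0 by simp
    finally have 2: "\<bar>v k i \<bullet> H y' (v k i) - v k i \<bullet> H (q k i) (v k i)\<bar> \<le> \<epsilon> k"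
      using mod[of "(y', v k i)" "(q k i, v k i)" k] y(2) qK vb(1) by (simp add: P_def)
    have "\<bar>(v k (i + 1) \<bullet> H y (v k (i + 1)) + v k i \<bullet> H y' (v k i)) / 2 - v k i \<bullet> H (q k i) (v k i)\<bar> \<le> \<epsilon> k"
      using 1 2 by (simp add: abs_le_iff field_simps)
    then show ?thesis
      using y(5) mult_left_mono[of _ "\<epsilon> k" "h k"] h[of k] by (meson less_imp_le order_trans)
  qed
  \<comment> \<open>The velocity is a backward difference, so the position step misses
    \<open>h * v\<close> by \<open>h\<close> times a velocity increment, which is of order
    \<open>h\<^sup>2\<close>.\<close>
  have pos_step: "norm (q k (i + 1) - q k i - h k *\<^sub>R v k i) \<le> h k * (h k * W)" for k i
  proof -
    have "q k (i + 1) - q k i - h k *\<^sub>R v k i = h k *\<^sub>R (v k (i + 1) - v k i)"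
      using h[of k] by (simp add: v_def algebra_simps)
    then show ?thesis
      using mult_left_mono[OF vb(2)[of k i], of "h k"] h[of k] by (simp add: W_def)
  qed
  obtain Z r where r: "strict_mono (r :: nat \<Rightarrow> nat)" and ZP: "\<And>t. Z t \<in> P" and Zper: "\<And>t. Z (t + \<omega>) = Z t"
    and Zder: "\<And>t. (Z has_vector_derivative \<Phi> (Z t)) (at t)"
    and Zunif: "\<And>e. e > 0 \<Longrightarrow> \<exists>k0. \<forall>k\<ge>k0. \<forall>t. norm (polygon (z (r k)) (t / h (r k)) - Z t) < e"
  proof (rule euler_limit[of P \<Phi> z N h \<omega> "\<lambda>k. h k * W + \<epsilon> k"])
    show "continuous_on P \<Phi>"
      using continuous_on_subset[OF continuous_on_acc PS]
      unfolding \<Phi>_def case_prod_unfold by (intro continuous_on_Pair continuous_on_snd continuous_on_id) auto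
    show "z k (i + N k) = z k i" for k i
      using admissible_periodic[OF adm, of k i] admissible_periodic[OF adm, of k "i - 1"]
      by (simp add: z_def v_def algebra_simps)
    show "(\<lambda>k. h k * W + \<epsilon> k) \<longlonglongrightarrow> 0"
      using tendsto_add[OF tendsto_mult_left_zero[OF hl, of W] \<epsilon>] by simp
    show "norm (z k (i + 1) - z k i - h k *\<^sub>R \<Phi> (z k i)) \<le> (h k * W + \<epsilon> k) * h k" for k i
      using order_trans[OF norm_Pair_le add_mono[OF pos_step[of k i] acc_step[of k i]]]
      by (simp add: z_def \<Phi>_def algebra_simps)
    show "h k * of_int (N k) = \<omega>" for k using Nh[of k] by (simp add: mult.commute)
  qed (use P zP h hl \<omega> in auto)
  define Q where "Q t = fst (Z t)" for t
  have Qder: "(Q has_vector_derivative snd (Z t)) (at t)" for t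
    using bounded_linear.has_vector_derivative[OF bounded_linear_fst Zder[of t]]
    by (simp add: Q_def[abs_def] \<Phi>_def case_prod_unfold)
  have Vder: "((\<lambda>t. snd (Z t)) has_vector_derivative acc (Q t) (snd (Z t))) (at t)" for t
    using bounded_linear.has_vector_derivative[OF bounded_linear_snd Zder[of t]]
    by (simp add: Q_def \<Phi>_def case_prod_unfold)
  have QS: "Q t \<in> S" for t using ZP[of t] PS by (auto simp: Q_def)
  have Qper: "Q (t + \<omega>) = Q t" for t by (simp add: Q_def Zper)
  \<comment> \<open>One mesh with error below \<open>\<delta> / 2\<close> suffices to carry the
    homotopy class over to the limit.\<close>
  obtain k where k: "\<And>t. norm (polygon (z (r k)) (t / h (r k)) - Z t) < \<delta> / 2"
    using Zunif[of "\<delta> / 2"] \<delta> by auto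
  let ?k = "r k"
  have "homotopic_loops S (\<lambda>s. polygon (q ?k) (of_int (N ?k) * s)) (\<lambda>s. Q (\<omega> * s))"
  proof (rule homotopic_loops_polygon[where \<delta> = \<delta>])
    show "q ?k (i + N ?k) = q ?k i" for i by (rule admissible_periodic[OF adm])
    have "continuous_on UNIV Q"
      by (intro continuous_at_imp_continuous_on ballI has_vector_derivative_continuous[OF Qder])
    then show "path (\<lambda>s. Q (\<omega> * s))"
      unfolding path_def by (rule continuous_on_compose2) (auto intro!: continuous_intros)
    show "pathfinish (\<lambda>s. Q (\<omega> * s)) = pathstart (\<lambda>s. Q (\<omega> * s))"
      using Qper[of 0] by (simp add: pathfinish_def pathstart_def)
    show "norm (Q (\<omega> * s) - polygon (q ?k) (of_int (N ?k) * s)) < \<delta> / 2" for s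
    proof -
      have "\<omega> * s / h ?k = of_int (N ?k) * s"
        using h[of ?k] by (simp add: Nh[of ?k, symmetric])
      moreover have "fst (polygon (z ?k) x) = polygon (q ?k) x" for x
        by (simp add: polygon_fst z_def)
      ultimately have "norm (fst (polygon (z ?k) (\<omega> * s / h ?k) - Z (\<omega> * s)))
          = norm (Q (\<omega> * s) - polygon (q ?k) (of_int (N ?k) * s))"
        by (simp add: Q_def norm_minus_commute)
      moreover have "norm (fst d) \<le> norm d" for d :: "'a \<times> 'a"
        by (metis norm_fst_le prod.collapse)
      ultimately show ?thesis using k[of "\<omega> * s"] by (metis order_le_less_trans)
    qed
  qed (use N0 ball step in auto)
  then have "homotopic_loops S \<kappa> (\<lambda>s. Q (\<omega> * s))"
    using adm[of ?k] homotopic_loops_trans unfolding admissible_def by blast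
  then show thesis by (rule that[OF QS Qper Qder Vder])
qed

text \<open>Since \<open>acc\<close> solves \<open>a + (a \<bullet> G + v \<bullet> H v) G = - g G\<close>, the Euler-Lagrange equation holds.\<close>

lemma lagrangian_solution_of_acc:
  assumes QS: "\<And>t. Q t \<in> S" and Q: "\<And>t. (Q has_vector_derivative V t) (at t)"
    and V: "\<And>t. (V has_vector_derivative acc (Q t) (V t)) (at t)"
    and L: "\<And>q v. q \<in> S \<Longrightarrow> L q v = \<mu> / 2 * ((norm v)\<^sup>2 + (G q \<bullet> v)\<^sup>2) - \<mu> * g * f q"
  shows "lagrangian_solution S L Q"
proof -
  define p where "p t = \<mu> *\<^sub>R (V t + (G (Q t) \<bullet> V t) *\<^sub>R G (Q t))" for t
  define F where "F t = \<mu> *\<^sub>R ((G (Q t) \<bullet> V t) *\<^sub>R H (Q t) (V t) - g *\<^sub>R G (Q t))" for t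
  have cQ: "continuous_on UNIV Q" and cV: "continuous_on UNIV V"
    by (intro continuous_at_imp_continuous_on ballI has_vector_derivative_continuous[OF Q]
        has_vector_derivative_continuous[OF V])+
  have "continuous_on UNIV (\<lambda>t. case (Q t, V t) of (q, v) \<Rightarrow> acc q v)"
    by (rule continuous_on_compose2[OF continuous_on_acc continuous_on_Pair[OF cQ cV]]) (use QS in auto)
  then have ca: "continuous_on UNIV (\<lambda>t. acc (Q t) (V t))" by simp
  have gp: "GDERIV (\<lambda>u. L (Q t) u) (V t) :> p t" for t
  proof -
    have "((\<lambda>v. \<mu> / 2 * (v \<bullet> v + (G (Q t) \<bullet> v)\<^sup>2) - \<mu> * g * f (Q t)) has_derivative
        (\<lambda>h. h \<bullet> p t)) (at (V t))"
      unfolding p_def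
      by (auto intro!: derivative_eq_intros
          simp: fun_eq_iff inner_add_right inner_commute algebra_simps)
    then show ?thesis
      by (simp add: gderiv_def L[OF QS] power2_norm_eq_inner)
  qed
  have gF: "GDERIV (\<lambda>q. L q (V t)) (Q t) :> F t" for t
  proof -
    let ?q = "Q t" and ?v = "V t"
    have f: "(f has_derivative (\<lambda>h. h \<bullet> G ?q)) (at ?q)"
      using grad_f[OF QS] by (simp add: gderiv_def)
    have "((\<lambda>q. \<mu> / 2 * ((norm ?v)\<^sup>2 + (G q \<bullet> ?v)\<^sup>2) - \<mu> * g * f q) has_derivative (\<lambda>h. h \<bullet> F t)) (at ?q)"
      unfolding F_def
      by (auto intro!: derivative_eq_intros hess_f[OF QS] f
          simp: fun_eq_iff hess_sym[OF QS] inner_diff_right algebra_simps)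
    \<comment> \<open>The formula for \<open>L\<close> is available on \<open>S\<close> only, so the
      derivative in \<open>q\<close> is transferred by means of openness of
      \<open>S\<close>.\<close>
    then show ?thesis
      unfolding gderiv_def
      by (rule has_derivative_transform_within_open[OF _ open_S QS]) (simp add: L)
  qed
  have pF: "(p has_vector_derivative F t) (at t)" for t
  proof -
    let ?q = "Q t" and ?v = "V t" and ?a = "acc (Q t) (V t)"
    have dG: "((\<lambda>t. G (Q t)) has_vector_derivative H ?q ?v) (at t)"
    proof -
      have "H ?q (d *\<^sub>R ?v) = d *\<^sub>R H ?q ?v" for d
        using has_derivative_linear[OF hess_f[OF QS]] by (rule linear_scale)
      then show ?thesis
        using has_derivative_compose[OF Q[of t, unfolded has_vector_derivative_def] hess_f[OF QS]]
        by (simp add: has_vector_derivative_def)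
    qed
    have dGV: "((\<lambda>t. G (Q t) \<bullet> V t) has_real_derivative (G ?q \<bullet> ?a + H ?q ?v \<bullet> ?v)) (at t)"
      unfolding has_field_derivative_def
      by (rule has_derivative_eq_rhs[OF has_derivative_inner[OF dG[unfolded has_vector_derivative_def]
              V[of t, unfolded has_vector_derivative_def]]])
         (simp add: fun_eq_iff algebra_simps)
    have "(p has_vector_derivative \<mu> *\<^sub>R (?a + ((G ?q \<bullet> ?v) *\<^sub>R H ?q ?v + (G ?q \<bullet> ?a + H ?q ?v \<bullet> ?v) *\<^sub>R G ?q))) (at t)"
      unfolding p_def
      by (intro bounded_linear.has_vector_derivative[OF bounded_linear_scaleR_right]
          has_vector_derivative_add V has_vector_derivative_scaleR[OF dGV dG])
    \<comment> \<open>The coefficient of \<open>G\<close> on the left is the second derivative of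
      \<open>f\<close> along the curve; the identity is the defining equation of
      \<open>acc\<close>.\<close>
    moreover have e: "?a + (G ?q \<bullet> ?a + H ?q ?v \<bullet> ?v) *\<^sub>R G ?q = - g *\<^sub>R G ?q"
    proof -
      let ?n = "1 + (norm (G ?q))\<^sup>2"
      define w where "w = ?v \<bullet> H ?q ?v"
      have n: "?n > 0" by (simp add: add_pos_nonneg)
      have a: "?a = (- (g + w) / ?n) *\<^sub>R G ?q" by (simp add: acc_def w_def)
      have "G ?q \<bullet> ?a = - (g + w) / ?n * (norm (G ?q))\<^sup>2"
        unfolding a by (simp add: power2_norm_eq_inner)
      then have "?a + (G ?q \<bullet> ?a + H ?q ?v \<bullet> ?v) *\<^sub>R G ?q
          = (- (g + w) / ?n + (- (g + w) / ?n * (norm (G ?q))\<^sup>2 + w)) *\<^sub>R G ?q"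
        by (simp add: a scaleR_add_left w_def inner_commute)
      also have "- (g + w) / ?n + (- (g + w) / ?n * (norm (G ?q))\<^sup>2 + w) = - g"
      proof -
        have "- (g + w) / n + (- (g + w) / n * (n - 1) + w) = - g" if "n > 0" for n :: real
          using that by (simp add: field_simps)
        from this[OF n] show ?thesis by simp
      qed
      finally show ?thesis by simp
    qed
    then have "F t = \<mu> *\<^sub>R ((G ?q \<bullet> ?v) *\<^sub>R H ?q ?v + (?a + (G ?q \<bullet> ?a + H ?q ?v \<bullet> ?v) *\<^sub>R G ?q))"
      by (simp add: F_def)
    ultimately show ?thesis by (simp only: add.left_commute)
  qed
  show ?thesis
    unfolding lagrangian_solution_def
    by (intro conjI allI exI[of _ V] exI[of _ "\<lambda>t. acc (Q t) (V t)"] exI[of _ p] exI[of _ F]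
        QS Q V ca gp gF pF)
qed

end

section \<open>Lassos and winding numbers\<close>

lemma rot_eq_axes:
  "rot \<theta> x = (cos \<theta> * x $ 1 - sin \<theta> * x $ 2) *\<^sub>R axis 1 1 + (sin \<theta> * x $ 1 + cos \<theta> * x $ 2) *\<^sub>R axis 2 1"
  by (simp add: rot_def vec_eq_iff forall_2 axis_def)

lemma rot_scaleR: "rot \<theta> (k *\<^sub>R x) = k *\<^sub>R rot \<theta> x"
  by (simp add: rot_def vec_eq_iff forall_2 algebra_simps)

lemma norm_rot: "norm (rot \<theta> x) = norm x"
proof -
  have n: "norm y = sqrt ((y $ 1)\<^sup>2 + (y $ 2)\<^sup>2)" for y :: "real^2"
    by (simp add: norm_eq_sqrt_inner inner_vec_def sum_2 power2_eq_square)
  have "(cos \<theta> * x $ 1 - sin \<theta> * x $ 2)\<^sup>2 + (sin \<theta> * x $ 1 + cos \<theta> * x $ 2)\<^sup>2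
      = ((cos \<theta>)\<^sup>2 + (sin \<theta>)\<^sup>2) * ((x $ 1)\<^sup>2 + (x $ 2)\<^sup>2)"
    by algebra
  then show ?thesis unfolding n by (simp add: rot_def)
qed

lemma rot_full_turn: "rot 0 x = x" "rot (2 * pi) x = x" "rot (- 2 * pi) x = x"
  by (simp_all add: rot_def vec_eq_iff forall_2)

text \<open>The direction \<open>w\<close> is fixed before the radius: at equal parameters, lassos
  of all radii lie on the same ray from \<open>c\<close>, at distances in (0, |c|]. Both the
  location of their images and the independence of the radius follow from this.\<close>

lemma lasso_on_ray:
  assumes c: "c \<noteq> 0" and t: "t \<in> {0..1}"
  obtains w where "norm w = 1"
    "\<And>\<rho>. 0 < \<rho> \<Longrightarrow> \<rho> < norm c \<Longrightarrow> \<exists>d>0. d \<le> norm c \<and> lasso c \<rho> \<theta> t = c - d *\<^sub>R w"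
proof -
  define b where "b = c /\<^sub>R norm c"
  have b: "norm b = 1" "c = norm c *\<^sub>R b" using c by (simp_all add: b_def)
  have e: "c - (\<rho> / norm c) *\<^sub>R c = c - \<rho> *\<^sub>R b" for \<rho> by (simp add: b_def divide_inverse)
  have line: "linepath 0 (c - \<rho> *\<^sub>R b) s = c - (norm c - s * (norm c - \<rho>)) *\<^sub>R b" for \<rho> s
  proof -
    have "linepath 0 (c - \<rho> *\<^sub>R b) s = s *\<^sub>R (norm c *\<^sub>R b - \<rho> *\<^sub>R b)"
      using b(2) by (simp add: linepath_def)
    also have "\<dots> = norm c *\<^sub>R b - (norm c - s * (norm c - \<rho>)) *\<^sub>R b"
      by (simp add: algebra_simps)
    finally show ?thesis using b(2) by simp
  qed
  have line': "linepath (c - \<rho> *\<^sub>R b) 0 s = linepath 0 (c - \<rho> *\<^sub>R b) (1 - s)" for \<rho> s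
    by (simp add: linepath_def)
  have d: "0 < norm c - s * (norm c - \<rho>) \<and> norm c - s * (norm c - \<rho>) \<le> norm c"
    if "0 < \<rho>" "\<rho> < norm c" "0 \<le> s" "s \<le> 1" for s \<rho>
    using that mult_left_le_one_le[of "norm c - \<rho>" s] mult_nonneg_nonneg[of s "norm c - \<rho>"] by linarith
  \<comment> \<open>The nested joins run the outgoing segment on [0, 1/2], the circle on [1/2, 3/4]
    and the way back on [3/4, 1].\<close>
  have lasso: "lasso c \<rho> \<theta> t =
     (if t \<le> 1 / 2 then linepath 0 (c - \<rho> *\<^sub>R b) (2 * t)
      else if 2 * t - 1 \<le> 1 / 2 then c + rot (\<theta> * (2 * (2 * t - 1))) (- (\<rho> *\<^sub>R b))
      else linepath (c - \<rho> *\<^sub>R b) 0 (2 * (2 * t - 1) - 1))" for \<rho>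
    by (simp add: lasso_def e joinpaths_def Let_def)
  consider "t \<le> 1 / 2" | "\<not> t \<le> 1 / 2" "2 * t - 1 \<le> 1 / 2" | "\<not> t \<le> 1 / 2" "\<not> 2 * t - 1 \<le> 1 / 2"
    by blast
  then show ?thesis
  proof cases
    case 1
    have "lasso c \<rho> \<theta> t = c - (norm c - 2 * t * (norm c - \<rho>)) *\<^sub>R b" for \<rho>
      using 1 by (simp only: lasso line if_True)
    then show ?thesis using that[OF b(1)] d[of _ "2 * t"] 1 t by fastforce
  next
    case 2
    have rot: "rot \<phi> (- (\<rho> *\<^sub>R b)) = - (\<rho> *\<^sub>R rot \<phi> b)" for \<phi> \<rho>
      using rot_scaleR[of \<phi> "- \<rho>" b] by simp
    show ?thesis
      using that[of "rot (\<theta> * (2 * (2 * t - 1))) b"] b(1) 2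
      by (auto simp: lasso rot norm_rot intro: less_imp_le)
  next
    case 3
    have "lasso c \<rho> \<theta> t = c - (norm c - (1 - (2 * (2 * t - 1) - 1)) * (norm c - \<rho>)) *\<^sub>R b" for \<rho>
      using 3 by (simp only: lasso line line' if_False)
    then show ?thesis using that[OF b(1)] d[of _ "1 - (2 * (2 * t - 1) - 1)"] 3 t by fastforce
  qed
qed

lemma lasso_image:
  assumes "c \<noteq> 0" "0 < \<rho>" "\<rho> < norm c"
  shows "path_image (lasso c \<rho> \<theta>) \<subseteq> cball c (norm c) - {c}"
proof
  fix x assume "x \<in> path_image (lasso c \<rho> \<theta>)"
  then obtain t where t: "t \<in> {0..1}" "x = lasso c \<rho> \<theta> t" by (auto simp: path_image_def)
  obtain w where "norm w = 1" "\<exists>d>0. d \<le> norm c \<and> lasso c \<rho> \<theta> t = c - d *\<^sub>R w"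
    using lasso_on_ray[OF assms(1) t(1)] assms(2,3) by metis
  then show "x \<in> cball c (norm c) - {c}" unfolding t(2) by (auto simp: dist_norm)
qed

text \<open>The two wells are \<open>2 * norm c\<close> apart, so a lasso about one of them cannot
  meet the other.\<close>

lemma cball_punctured_subset:
  fixes c :: "'a::real_normed_vector"
  assumes "c \<noteq> 0"
  shows "cball c (norm c) - {c} \<subseteq> - {c, - c}"
proof -
  have "dist c (- c) = 2 * norm c"
    using scaleR_2[of c] by (simp add: dist_norm flip: scaleR_2)
  then show ?thesis using assms by auto
qed

lemma lasso_path:
  assumes c: "c \<noteq> 0" and \<rho>: "0 < \<rho>" "\<rho> < norm c" and \<theta>: "\<And>x. rot \<theta> x = x"
  shows "path (lasso c \<rho> \<theta>)" "pathstart (lasso c \<rho> \<theta>) = 0" "pathfinish (lasso c \<rho> \<theta>) = 0"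
proof -
  define e where "e = c - (\<rho> / norm c) *\<^sub>R c"
  have "path (\<lambda>s. c + rot (\<theta> * s) (e - c))"
    unfolding path_def rot_eq_axes by (intro continuous_intros)
  then have "path (linepath 0 e +++ ((\<lambda>s. c + rot (\<theta> * s) (e - c)) +++ linepath e 0))"
    by (intro path_join_imp path_linepath) (simp_all add: pathstart_def pathfinish_def joinpaths_def linepath_def rot_full_turn \<theta>)
  then show "path (lasso c \<rho> \<theta>)" by (simp only: lasso_def Let_def e_def)
qed (simp_all add: lasso_def Let_def)

text \<open>The straight-line homotopy slides each point along its ray from \<open>c\<close>; a
  convex combination of two distances in (0, |c|] stays in that range.\<close>

lemma lasso_homotopic:
  assumes c: "c \<noteq> 0" and \<rho>: "0 < \<rho>" "\<rho> < norm c" and \<rho>': "0 < \<rho>'" "\<rho>' < norm c"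
    and \<theta>: "\<And>x. rot \<theta> x = x"
  shows "homotopic_paths (- {c, - c}) (lasso c \<rho> \<theta>) (lasso c \<rho>' \<theta>)"
proof (rule homotopic_paths_linear)
  fix t :: real assume t: "t \<in> {0..1}"
  obtain w where w: "norm w = 1"
    "\<And>\<rho>. 0 < \<rho> \<Longrightarrow> \<rho> < norm c \<Longrightarrow> \<exists>d>0. d \<le> norm c \<and> lasso c \<rho> \<theta> t = c - d *\<^sub>R w"
    using lasso_on_ray[OF c t] by metis
  obtain d d' where d: "d > 0" "d \<le> norm c" "lasso c \<rho> \<theta> t = c - d *\<^sub>R w"
    and d': "d' > 0" "d' \<le> norm c" "lasso c \<rho>' \<theta> t = c - d' *\<^sub>R w"
    using w(2) \<rho> \<rho>' by metis
  have "closed_segment (lasso c \<rho> \<theta> t) (lasso c \<rho>' \<theta> t) \<subseteq> cball c (norm c) - {c}"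
  proof
    fix x assume "x \<in> closed_segment (lasso c \<rho> \<theta> t) (lasso c \<rho>' \<theta> t)"
    then obtain u where u: "0 \<le> u" "u \<le> 1" "x = (1 - u) *\<^sub>R (c - d *\<^sub>R w) + u *\<^sub>R (c - d' *\<^sub>R w)"
      by (auto simp: closed_segment_def d(3) d'(3))
    have x: "x = c - ((1 - u) * d + u * d') *\<^sub>R w" by (simp add: u(3) algebra_simps)
    have "(1 - u) * min d d' + u * min d d' \<le> (1 - u) * d + u * d'"
      using u by (intro add_mono mult_left_mono) auto
    moreover have "(1 - u) * min d d' + u * min d d' = min d d'" by (simp add: algebra_simps)
    moreover have "(1 - u) * d + u * d' \<le> norm c"
      using u d d' by (intro convex_bound_le) auto
    ultimately have "(1 - u) * d + u * d' \<in> {0<..norm c}" using d(1) d'(1) by auto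
    then show "x \<in> cball c (norm c) - {c}" using w(1) by (auto simp: x dist_norm)
  qed
  then show "closed_segment (lasso c \<rho> \<theta> t) (lasso c \<rho>' \<theta> t) \<subseteq> - {c, - c}"
    using cball_punctured_subset[OF c] by blast
qed (use lasso_path[of c _ \<theta>] assms in auto)

lemma loop_copies_loop:
  assumes "m \<ge> 1" "path p" "pathfinish p = pathstart p" "path_image p \<subseteq> S"
  shows "path (loop_copies m p) \<and> pathstart (loop_copies m p) = pathstart p \<and>
    pathfinish (loop_copies m p) = pathstart p \<and> path_image (loop_copies m p) \<subseteq> S"
  using assms by (induction m p rule: loop_copies.induct) (auto simp: path_image_join)

lemma loop_copies_homotopic:
  assumes "m \<ge> 1" "homotopic_paths S p q" "pathfinish p = pathstart p"
  shows "homotopic_paths S (loop_copies m p) (loop_copies m q)"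
  using assms(1)
proof (induction m rule: nat_induct_at_least)
  case base
  then show ?case using assms(2) by simp
next
  case (Suc m)
  have "path p" "path_image p \<subseteq> S"
    using homotopic_paths_imp_path[OF assms(2)] homotopic_paths_imp_subset[OF assms(2)] by auto
  then have "pathfinish p = pathstart (loop_copies m p)"
    using loop_copies_loop[of m p S] assms(3) Suc by simp
  then show ?case
    using homotopic_paths_join[OF assms(2) Suc.IH] Suc.hyps by (cases m) auto
qed

section \<open>Winding numbers in the real plane via complex numbers\<close>

definition complex_from :: "real^2 \<Rightarrow> real^2 \<Rightarrow> complex" where
  "complex_from c x = of_real (x $ 1 - c $ 1) + \<i> * of_real (x $ 2 - c $ 2)"

lemma continuous_on_complex_from: "continuous_on A (complex_from c)"
  unfolding complex_from_def by (intro continuous_intros)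

lemma complex_from_eq_0_iff [simp]: "complex_from c x = 0 \<longleftrightarrow> x = c"
  by (simp add: complex_from_def complex_eq_iff vec_eq_iff forall_2)

lemma complex_from_rot: "complex_from c (c + rot \<theta> x) = exp (\<i> * of_real \<theta>) * complex_from c (c + x)"
  by (simp add: complex_from_def rot_def complex_eq_iff algebra_simps flip: cis_conv_exp)

definition winding :: "real^2 \<Rightarrow> (real \<Rightarrow> real^2) \<Rightarrow> complex" where
  "winding c p = winding_number (complex_from c \<circ> p) 0"

lemma path_complex_from:
  assumes "path p" "c \<notin> path_image p"
  shows "path (complex_from c \<circ> p)" "0 \<notin> path_image (complex_from c \<circ> p)"
  using assms by (auto intro!: path_continuous_image continuous_on_complex_from simp: path_image_def)

lemma winding_join:
  assumes "path p" "c \<notin> path_image p" "path q" "c \<notin> path_image q" "pathfinish p = pathstart q"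
  shows "winding c (p +++ q) = winding c p + winding c q"
  unfolding winding_def path_compose_join
  by (rule winding_number_join) (use assms path_complex_from in \<open>auto simp: pathfinish_compose pathstart_compose\<close>)

lemma winding_loop_copies:
  assumes "m \<ge> 1" "path p" "pathfinish p = pathstart p" "c \<notin> path_image p"
  shows "winding c (loop_copies m p) = of_nat m * winding c p"
  using assms(1)
proof (induction m rule: nat_induct_at_least)
  case (Suc m)
  have "path (loop_copies m p) \<and> pathstart (loop_copies m p) = pathstart p \<and>
      path_image (loop_copies m p) \<subseteq> - {c}"
    using loop_copies_loop[of m p "- {c}"] assms Suc by auto
  then have "winding c (p +++ loop_copies m p) = winding c p + winding c (loop_copies m p)"
    by (intro winding_join) (use assms in auto)
  then show ?case using Suc by (cases m) (auto simp: algebra_simps)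
qed simp

lemma winding_homotopic_loops:
  assumes "homotopic_loops S p q" "c \<notin> S"
  shows "winding c p = winding c q"
  unfolding winding_def
  by (rule winding_number_homotopic_loops,
      rule homotopic_loops_continuous_image[OF assms(1) continuous_on_complex_from])
     (use assms(2) in auto)

text \<open>The way back reverses the way out, so their contributions cancel although neither is an
  integer in general; the circle alone counts.\<close>

lemma winding_lasso:
  assumes c: "c \<noteq> 0" and \<rho>: "0 < \<rho>" "\<rho> < norm c"
  shows "winding c (lasso c \<rho> (- 2 * pi)) = - 1"
proof -
  define e where "e = c - (\<rho> / norm c) *\<^sub>R c"
  define circ where "circ = (\<lambda>s. c + rot (- 2 * pi * s) (e - c))"
  let ?X = "complex_from c e"
  have img: "path_image (lasso c \<rho> (- 2 * pi)) \<subseteq> - {c}"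
    using lasso_image[OF c \<rho>] by blast
  have lasso: "lasso c \<rho> (- 2 * pi) = linepath 0 e +++ (circ +++ linepath e 0)"
    by (simp add: lasso_def e_def circ_def Let_def)
  have ends: "pathstart circ = e" "pathfinish circ = e"
    by (simp_all add: circ_def pathstart_def pathfinish_def rot_full_turn rot_full_turn(3)[simplified])
  have pc: "path circ" unfolding circ_def path_def rot_eq_axes by (intro continuous_intros)
  have out: "c \<notin> path_image (linepath 0 e)" "c \<notin> path_image circ" "c \<notin> path_image (linepath e 0)"
    using img unfolding lasso by (auto simp: path_image_join ends)
  have X0: "?X \<noteq> 0" using out(1) by (auto simp: path_image_linepath)
  \<comment> \<open>In logarithmic coordinates the clockwise circle is a vertical segment of length
    \<open>2 * pi\<close> run downwards, and the winding number is the difference of its ends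
    divided by 2 pi i.\<close>
  have "complex_from c \<circ> circ = exp \<circ> (\<lambda>s. Ln ?X + \<i> * of_real (- 2 * pi * s))"
  proof
    fix s
    have "complex_from c (circ s) = exp (\<i> * of_real (- 2 * pi * s)) * ?X"
      unfolding circ_def by (subst complex_from_rot) simp
    also have "\<dots> = exp (Ln ?X + \<i> * of_real (- 2 * pi * s))"
      by (simp only: exp_add exp_Ln[OF X0] mult.commute)
    finally show "(complex_from c \<circ> circ) s = (exp \<circ> (\<lambda>s. Ln ?X + \<i> * of_real (- 2 * pi * s))) s"
      by simp
  qed
  moreover have "winding_number (exp \<circ> (\<lambda>s. Ln ?X + \<i> * of_real (- 2 * pi * s))) 0 = - 1"
    by (subst winding_number_compose_exp)
       (auto simp: path_def pathfinish_def pathstart_def intro!: continuous_intros)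
  ultimately have circ: "winding c circ = - 1" by (simp add: winding_def)
  have "linepath e 0 = reversepath (linepath 0 e)" by simp
  then have return: "winding c (linepath e 0) = - winding c (linepath 0 e)"
    unfolding winding_def
    using winding_number_reversepath[OF path_complex_from[OF path_linepath out(1)]]
    by (simp only: path_compose_reversepath)
  have "winding c (lasso c \<rho> (- 2 * pi))
      = winding c (linepath 0 e) + (winding c circ + winding c (linepath e 0))"
    unfolding lasso using out pc ends by (simp add: winding_join path_image_join)
  then show ?thesis by (simp add: circ return)
qed

text \<open>The lasso about \<open>- c\<close> stays in the ball of radius \<open>norm c\<close>
  about \<open>- c\<close>. Its affine image in the complex plane is convex and misses 0, so the
  winding number vanishes.\<close>

lemma winding_lasso_other:
  assumes c: "c \<noteq> 0" and \<rho>: "0 < \<rho>" "\<rho> < norm c"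
  shows "winding c (lasso (- c) \<rho> (2 * pi)) = 0"
proof -
  have c': "- c \<noteq> 0" "\<rho> < norm (- c)" using assms by auto
  note lp = lasso_path[OF c'(1) \<rho>(1) c'(2) rot_full_turn(2)]
  have img: "path_image (lasso (- c) \<rho> (2 * pi)) \<subseteq> cball (- c) (norm c)"
    using lasso_image[OF c'(1) \<rho>(1) c'(2), of "2 * pi"] by auto
  have cn: "c \<notin> cball (- c) (norm c)"
  proof -
    have "- c - c = - (2 *\<^sub>R c)" by (simp add: scaleR_2)
    then have "dist (- c) c = 2 * norm c" by (simp add: dist_norm)
    then show ?thesis using c by simp
  qed
  have lin: "linear (complex_from 0)"
    by (rule linearI) (simp_all add: complex_from_def complex_eq_iff algebra_simps)
  have "complex_from c = (\<lambda>z. z - complex_from 0 c) \<circ> complex_from 0"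
    by (auto simp: complex_from_def fun_eq_iff algebra_simps)
  then have "complex_from c ` cball (- c) (norm c)
      = (\<lambda>z. z - complex_from 0 c) ` complex_from 0 ` cball (- c) (norm c)"
    by (simp add: image_comp)
  moreover have "convex \<dots>"
    using convex_linear_image[OF lin convex_cball] by (intro convex_translation_subtract) 
  ultimately have conv: "convex (complex_from c ` cball (- c) (norm c))" by simp
  show ?thesis
    unfolding winding_def
  proof (rule winding_number_zero_outside[OF _ conv])
    show "path (complex_from c \<circ> lasso (- c) \<rho> (2 * pi))"
      using lp(1) by (intro path_continuous_image continuous_on_complex_from)
    show "path_image (complex_from c \<circ> lasso (- c) \<rho> (2 * pi)) \<subseteq> complex_from c ` cball (- c) (norm c)"
      using img by (auto simp: path_image_def)
  qed (use lp cn in \<open>auto simp: pathfinish_compose pathstart_compose\<close>)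
qed

section \<open>The homotopy class of the coiling curve\<close>

definition coil :: "nat \<Rightarrow> real^2 \<Rightarrow> real \<Rightarrow> real \<Rightarrow> real^2" where
  "coil m r0 \<rho> = loop_copies m (lasso r0 \<rho> (- 2 * pi)) +++ loop_copies m (lasso (- r0) \<rho> (2 * pi))"

lemma coil_pieces:
  assumes r0: "r0 \<noteq> 0" and \<rho>: "0 < \<rho>" "\<rho> < norm r0" and m: "m \<ge> 1"
  defines "p \<equiv> loop_copies m (lasso r0 \<rho> (- 2 * pi))" and "q \<equiv> loop_copies m (lasso (- r0) \<rho> (2 * pi))"
  shows "path p" "path q"
    "pathstart p = 0" "pathfinish p = 0" "pathstart q = 0" "pathfinish q = 0"
    "path_image p \<subseteq> - {r0, - r0}" "path_image q \<subseteq> - {r0, - r0}"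
proof -
  have c': "- r0 \<noteq> 0" "\<rho> < norm (- r0)" using assms by auto
  have ins: "- {- r0, - (- r0)} = - {r0, - r0}" by auto
  have "path_image (lasso r0 \<rho> (- 2 * pi)) \<subseteq> - {r0, - r0}"
    using order_trans[OF lasso_image[OF r0 \<rho>] cball_punctured_subset[OF r0]] .
  then have p: "path p \<and> pathstart p = 0 \<and> pathfinish p = 0 \<and> path_image p \<subseteq> - {r0, - r0}"
    unfolding p_def using loop_copies_loop[OF m] lasso_path[OF r0 \<rho> rot_full_turn(3)] by metis
  have "path_image (lasso (- r0) \<rho> (2 * pi)) \<subseteq> - {r0, - r0}"
    using order_trans[OF lasso_image[OF c'(1) \<rho>(1) c'(2)] cball_punctured_subset[OF c'(1)]]
    unfolding ins .
  then have q: "path q \<and> pathstart q = 0 \<and> pathfinish q = 0 \<and> path_image q \<subseteq> - {r0, - r0}"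
    unfolding q_def using loop_copies_loop[OF m] lasso_path[OF c'(1) \<rho>(1) c'(2) rot_full_turn(2)] by metis
  show "path p" "path q" "pathstart p = 0" "pathfinish p = 0" "pathstart q = 0" "pathfinish q = 0"
    "path_image p \<subseteq> - {r0, - r0}" "path_image q \<subseteq> - {r0, - r0}"
    using p q by blast+
qed

text \<open>The solution is constructed in the class of a single radius, whereas
  \<open>coils\<close> and \<open>figure_eight\<close> ask for every radius; this bridges the
  gap.\<close>

lemma coil_homotopic:
  assumes r0: "r0 \<noteq> 0" and \<rho>: "0 < \<rho>" "\<rho> < norm r0" and \<rho>': "0 < \<rho>'" "\<rho>' < norm r0" and m: "m \<ge> 1"
  shows "homotopic_loops (- {r0, - r0}) (coil m r0 \<rho>) (coil m r0 \<rho>')"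
proof -
  have c': "- r0 \<noteq> 0" "\<rho> < norm (- r0)" "\<rho>' < norm (- r0)" using assms by auto
  have ins: "- {- r0, - (- r0)} = - {r0, - r0}" by auto
  note cp = coil_pieces[OF r0 \<rho> m]
  have 1: "homotopic_paths (- {r0, - r0}) (loop_copies m (lasso r0 \<rho> (- 2 * pi))) (loop_copies m (lasso r0 \<rho>' (- 2 * pi)))"
    using lasso_path[OF r0 \<rho> rot_full_turn(3)]
    by (intro loop_copies_homotopic m lasso_homotopic r0 \<rho> \<rho>' rot_full_turn(3)) simp
  have 2: "homotopic_paths (- {r0, - r0}) (loop_copies m (lasso (- r0) \<rho> (2 * pi))) (loop_copies m (lasso (- r0) \<rho>' (2 * pi)))"
    using lasso_path[OF c'(1) \<rho>(1) c'(2) rot_full_turn(2)]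
      lasso_homotopic[OF c'(1) \<rho>(1) c'(2) \<rho>'(1) c'(3) rot_full_turn(2), unfolded ins]
    by (intro loop_copies_homotopic m) simp_all
  have "homotopic_paths (- {r0, - r0}) (coil m r0 \<rho>) (coil m r0 \<rho>')"
    unfolding coil_def by (rule homotopic_paths_join[OF 1 2]) (use cp in simp)
  then show ?thesis
    by (rule homotopic_paths_imp_homotopic_loops)
       (use cp coil_pieces[OF r0 \<rho>' m] in \<open>simp_all add: coil_def\<close>)
qed

lemma coil_not_null_homotopic:
  assumes r0: "r0 \<noteq> 0" and \<rho>: "0 < \<rho>" "\<rho> < norm r0" and m: "m \<ge> 1"
  shows "\<not> homotopic_loops (- {r0, - r0}) (coil m r0 \<rho>) (\<lambda>_. a)"
proof
  assume hom: "homotopic_loops (- {r0, - r0}) (coil m r0 \<rho>) (\<lambda>_. a)"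
  then have "a \<noteq> r0"
    using homotopic_loops_imp_subset[OF hom] by (auto simp: path_image_def)
  then have "winding r0 (\<lambda>_. a) = 0"
    by (simp add: winding_def o_def winding_number_zero_const)
  then have 0: "winding r0 (coil m r0 \<rho>) = 0"
    using winding_homotopic_loops[OF hom, of r0] by simp
  have c': "- r0 \<noteq> 0" "\<rho> < norm (- r0)" using assms by auto
  note cp = coil_pieces[OF r0 \<rho> m]
  have out: "r0 \<notin> path_image (lasso r0 \<rho> (- 2 * pi))" "r0 \<notin> path_image (lasso (- r0) \<rho> (2 * pi))"
    using lasso_image[OF r0 \<rho>] order_trans[OF lasso_image[OF c'(1) \<rho>(1) c'(2)] cball_punctured_subset[OF c'(1)]]
    by auto
  have "winding r0 (coil m r0 \<rho>) = winding r0 (loop_copies m (lasso r0 \<rho> (- 2 * pi)))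
      + winding r0 (loop_copies m (lasso (- r0) \<rho> (2 * pi)))"
    unfolding coil_def by (rule winding_join) (use cp in auto)
  also have "\<dots> = of_nat m * - 1 + of_nat m * 0"
    using winding_loop_copies[OF m _ _ out(1)] winding_loop_copies[OF m _ _ out(2)]
      lasso_path[OF r0 \<rho> rot_full_turn(3)] lasso_path[OF c'(1) \<rho>(1) c'(2) rot_full_turn(2)]
      winding_lasso[OF r0 \<rho>] winding_lasso_other[OF r0 \<rho>]
    by simp
  finally show False using 0 m by simp
qed

section \<open>The two wells\<close>

lemma powr_inner_derivative:
  fixes q c :: "'a::real_inner"
  assumes "q \<noteq> c"
  shows "((\<lambda>q. ((q - c) \<bullet> (q - c)) powr a) has_derivative
    (\<lambda>u. 2 * a * ((q - c) \<bullet> (q - c)) powr (a - 1) * ((q - c) \<bullet> u))) (at q)"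
proof -
  have pos: "(q - c) \<bullet> (q - c) > 0" using assms by simp
  have "((\<lambda>q. (q - c) \<bullet> (q - c)) has_derivative (\<lambda>u. 2 * ((q - c) \<bullet> u))) (at q)"
    by (rule has_derivative_eq_rhs, (rule derivative_eq_intros refl)+)
       (simp add: fun_eq_iff inner_commute)
  from has_derivative_compose[OF this has_real_derivative_powr[OF pos, unfolded has_field_derivative_def]]
  show ?thesis by (rule has_derivative_eq_rhs) (simp add: fun_eq_iff mult_ac)
qed

text \<open>Powers of \<open>x \<bullet> x\<close> can be differentiated without the derivative of
  the norm. At \<open>x = 0\<close> both sides are 0, by \<open>0 powr a = 0\<close> and division by
  zero.\<close>

lemma norm_powr_eq: "1 / norm x powr n = (x \<bullet> x) powr (- (n / 2))"
proof (cases "x = 0")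
  case False
  have "(x \<bullet> x) powr (n / 2) = (norm x powr 2) powr (n / 2)"
    using False by (simp add: power2_norm_eq_inner powr_realpow[of "norm x" 2, simplified])
  also have "\<dots> = norm x powr n" by (simp only: powr_powr) simp
  finally show ?thesis by (simp add: powr_minus_divide)
qed simp

text \<open>Gradient of - 1 / |q - c|^k, that is k |q - c|^(-k-2) (q - c), written with powers of
  the squared distance.\<close>

definition well_grad :: "real \<Rightarrow> 'a::real_inner \<Rightarrow> 'a \<Rightarrow> 'a" where
  "well_grad k c q = (k * ((q - c) \<bullet> (q - c)) powr (- (k / 2) - 1)) *\<^sub>R (q - c)"

text \<open>Derivative of \<open>well_grad\<close>: a multiple of the identity plus a rank-one term
  along \<open>q - c\<close>, hence symmetric.\<close>

definition well_hess :: "real \<Rightarrow> 'a::real_inner \<Rightarrow> 'a \<Rightarrow> 'a \<Rightarrow> 'a" where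
  "well_hess k c q u = (k * ((q - c) \<bullet> (q - c)) powr (- (k / 2) - 1)) *\<^sub>R u
     - (k * (k + 2) * ((q - c) \<bullet> (q - c)) powr (- (k / 2) - 2) * ((q - c) \<bullet> u)) *\<^sub>R (q - c)"

lemma well_grad_derivative:
  assumes "q \<noteq> c"
  shows "((\<lambda>q. - (1 / norm (q - c) powr k)) has_derivative (\<lambda>u. u \<bullet> well_grad k c q)) (at q)"
  unfolding norm_powr_eq
  by (rule has_derivative_eq_rhs[OF has_derivative_minus[OF powr_inner_derivative[OF assms]]])
     (simp add: fun_eq_iff well_grad_def inner_commute)

lemma well_hess_derivative:
  assumes "q \<noteq> c"
  shows "(well_grad k c has_derivative well_hess k c q) (at q)"
proof -
  have e: "- (k / 2) - 1 - 1 = - (k / 2) - 2" by simp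
  have id: "((\<lambda>q. q - c) has_derivative (\<lambda>u. u)) (at q)"
    by (auto intro!: derivative_eq_intros)
  have "((\<lambda>q. (k * ((q - c) \<bullet> (q - c)) powr (- (k / 2) - 1)) *\<^sub>R (q - c)) has_derivative well_hess k c q) (at q)"
    by (rule has_derivative_eq_rhs[OF has_derivative_scaleR[OF
            has_derivative_mult_right[OF powr_inner_derivative[OF assms]] id]])
       (simp add: fun_eq_iff well_hess_def e algebra_simps)
  then show ?thesis by (simp add: well_grad_def[abs_def])
qed

lemma well_hess_sym: "well_hess k c q u \<bullet> v = u \<bullet> well_hess k c q v"
  by (simp add: well_hess_def inner_diff_left inner_diff_right inner_commute)

lemma continuous_on_well_hess:
  assumes "c \<notin> S"
  shows "continuous_on (S \<times> UNIV) (\<lambda>(q, u). well_hess k c q u)"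
  unfolding well_hess_def case_prod_unfold
  by (intro continuous_intros) (use assms in auto)

definition two_wells_grad :: "real \<Rightarrow> real \<Rightarrow> real^2 \<Rightarrow> real^2 \<Rightarrow> real^2" where
  "two_wells_grad \<gamma> n r0 q = \<gamma> *\<^sub>R (well_grad n r0 q + well_grad n (- r0) q)"

definition two_wells_hess :: "real \<Rightarrow> real \<Rightarrow> real^2 \<Rightarrow> real^2 \<Rightarrow> real^2 \<Rightarrow> real^2" where
  "two_wells_hess \<gamma> n r0 q u = \<gamma> *\<^sub>R (well_hess n r0 q u + well_hess n (- r0) q u)"

text \<open>The two wells contribute with the same sign, so a lower bound on their sum bounds each
  term separately and can be solved for the distance.\<close>

lemma two_wells_barrier:
  assumes "\<gamma> > 0" "n > 0"
  shows "\<exists>\<delta>>0. \<forall>q\<in>- {r0, - r0}. - C \<le> two_wells \<gamma> n r0 q \<longrightarrow> ball q \<delta> \<subseteq> - {r0, - r0}"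
proof -
  \<comment> \<open>The maximum with 1 makes \<open>M\<close> positive for every \<open>C\<close>;
    then \<open>\<delta>\<close> is the distance at which a single well has depth
    \<open>M\<close>.\<close>
  define M where "M = max C 1"
  define \<delta> where "\<delta> = (\<gamma> / M) powr (1 / n)"
  have M: "M > 0" "C \<le> M" by (auto simp: M_def)
  have \<delta>: "\<delta> > 0" "\<delta> powr n = \<gamma> / M"
    using assms M by (auto simp: \<delta>_def powr_powr)
  have far: "\<delta> \<le> norm x" if x: "x \<noteq> 0" "\<gamma> * (1 / norm x powr n) \<le> M" for x :: "real^2"
  proof (rule ccontr)
    assume "\<not> \<delta> \<le> norm x"
    then have "norm x powr n < \<gamma> / M"
      using powr_less_mono2[of n "norm x" \<delta>] assms \<delta> by simp
    then show False using x M assms by (simp add: field_simps)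
  qed
  have "ball q \<delta> \<subseteq> - {r0, - r0}"
    if q: "q \<in> - {r0, - r0}" and le: "- C \<le> two_wells \<gamma> n r0 q" for q
  proof -
    have n0: "0 \<le> \<gamma> * (1 / norm (q - r0) powr n)" "0 \<le> \<gamma> * (1 / norm (q + r0) powr n)"
      using assms by simp_all
    have "\<gamma> * (1 / norm (q - r0) powr n) + \<gamma> * (1 / norm (q + r0) powr n) \<le> M"
      using le M(2) by (simp add: two_wells_def distrib_left)
    then have "\<gamma> * (1 / norm (q - r0) powr n) \<le> M" "\<gamma> * (1 / norm (q + r0) powr n) \<le> M"
      using n0 by linarith+
    moreover have "q - r0 \<noteq> 0" "q + r0 \<noteq> 0" using q by (auto simp: add_eq_0_iff2)
    ultimately have "\<delta> \<le> norm (q - r0)" "\<delta> \<le> norm (q + r0)" using far by blast+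
    then show ?thesis by (auto simp: dist_norm)
  qed
  then show ?thesis using \<delta>(1) by blast
qed

lemma two_wells_sliding_surface:
  assumes \<gamma>: "\<gamma> > 0" and n: "n > 0" and g: "g > 0"
  shows "sliding_surface (- {r0, - r0}) (two_wells \<gamma> n r0) (two_wells_grad \<gamma> n r0) (two_wells_hess \<gamma> n r0) g"
proof
  show "open (- {r0, - r0})" by (intro open_Compl finite_imp_closed) simp
  show "bounded (- (- {r0, - r0}))" by simp
  show "g > 0" by (rule g)
  fix q :: "real^2" assume q: "q \<in> - {r0, - r0}"
  then have q': "q \<noteq> r0" "q \<noteq> - r0" by auto
  show "GDERIV (two_wells \<gamma> n r0) q :> two_wells_grad \<gamma> n r0 q"
  proof -
    have "((\<lambda>q. \<gamma> * (- (1 / norm (q - r0) powr n) + - (1 / norm (q - (- r0)) powr n))) has_derivative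
        (\<lambda>u. \<gamma> * (u \<bullet> well_grad n r0 q + u \<bullet> well_grad n (- r0) q))) (at q)"
      by (intro has_derivative_mult_right has_derivative_add well_grad_derivative q')
    then show ?thesis
      by (simp add: gderiv_def two_wells_def[abs_def] two_wells_grad_def inner_add_right algebra_simps)
  qed
  show "(two_wells_grad \<gamma> n r0 has_derivative two_wells_hess \<gamma> n r0 q) (at q)"
    unfolding two_wells_grad_def[abs_def] two_wells_hess_def[abs_def]
    by (intro has_derivative_scaleR_right has_derivative_add well_hess_derivative q')
  show "two_wells_hess \<gamma> n r0 q u \<bullet> v = u \<bullet> two_wells_hess \<gamma> n r0 q v" for u v
    by (simp add: two_wells_hess_def inner_add_left inner_add_right well_hess_sym)
  show "two_wells \<gamma> n r0 q \<le> 0"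
    using \<gamma> by (simp add: two_wells_def mult_nonneg_nonneg)
next
  show "continuous_on ((- {r0, - r0}) \<times> UNIV) (\<lambda>(q, u). two_wells_hess \<gamma> n r0 q u)"
    using continuous_on_well_hess[of r0 "- {r0, - r0}" n] continuous_on_well_hess[of "- r0" "- {r0, - r0}" n]
    unfolding two_wells_hess_def case_prod_unfold by (intro continuous_intros) auto
  show "\<exists>\<delta>>0. \<forall>q\<in>- {r0, - r0}. - C \<le> two_wells \<gamma> n r0 q \<longrightarrow> ball q \<delta> \<subseteq> - {r0, - r0}" for C
    by (rule two_wells_barrier[OF \<gamma> n])
qed

theorem mainTheorem3:
  fixes \<mu> g \<gamma> \<omega> n :: real and r0 :: "real^2" and m :: nat
  assumes "\<mu> > 0" and "g > 0" and "\<gamma> > 0" and "r0 \<noteq> 0"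
    and "\<omega> > 0" and "n \<ge> 2" and "m \<ge> 1"
  shows "\<exists>r :: real \<Rightarrow> real^2.
           lagrangian_solution (- {r0, - r0}) (sliding_lagrangian \<mu> g (two_wells \<gamma> n r0)) r \<and>
           (\<forall>t. r (t + \<omega>) = r t) \<and>
           coils m r0 \<omega> r \<and>
           (m = 1 \<longrightarrow> figure_eight r0 \<omega> r)"
proof -
  interpret sliding_surface "- {r0, - r0}" "two_wells \<gamma> n r0" "two_wells_grad \<gamma> n r0" "two_wells_hess \<gamma> n r0" g
    using assms by (intro two_wells_sliding_surface) auto
  \<comment> \<open>An arbitrary admissible radius for the loop that defines the class.\<close>
  have \<rho>: "0 < norm r0 / 2" "norm r0 / 2 < norm r0" using assms(4) by auto
  let ?\<kappa> = "coil m r0 (norm r0 / 2)"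
  have refl: "homotopic_loops (- {r0, - r0}) ?\<kappa> ?\<kappa>"
    by (rule coil_homotopic[OF assms(4) \<rho> \<rho> assms(7)])
  show ?thesis
  proof (rule periodic_solution_in_class[OF refl coil_not_null_homotopic[OF assms(4) \<rho> assms(7)] assms(5)])
    fix Q V
    assume Q: "\<And>t. Q t \<in> - {r0, - r0}" "\<And>t. Q (t + \<omega>) = Q t"
    "\<And>t. (Q has_vector_derivative V t) (at t)"
    "\<And>t. (V has_vector_derivative acc (Q t) (V t)) (at t)"
    "homotopic_loops (- {r0, - r0}) ?\<kappa> (\<lambda>s. Q (\<omega> * s))"
  have sol: "lagrangian_solution (- {r0, - r0}) (sliding_lagrangian \<mu> g (two_wells \<gamma> n r0)) Q"
    by (rule lagrangian_solution_of_acc[OF Q(1,3,4)])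
       (simp add: sliding_lagrangian_def GDERIV_imp_grad[OF grad_f])
  \<comment> \<open>All radii give the same class; for \<open>m = 1\<close>,
    \<open>loop_copies\<close> returns the lasso itself, so the same fact yields
    \<open>figure_eight\<close>.\<close>
  have hom: "homotopic_loops (- {r0, - r0}) (\<lambda>s. Q (\<omega> * s)) (coil m r0 \<rho>)"
    if "0 < \<rho>" "\<rho> < norm r0" for \<rho>
    using homotopic_loops_trans[OF homotopic_loops_sym[OF Q(5)] coil_homotopic[OF assms(4) \<rho> that assms(7)]] .
  then have "coils m r0 \<omega> Q" by (simp add: coils_def coil_def)
  moreover have "m = 1 \<longrightarrow> figure_eight r0 \<omega> Q" using hom by (auto simp: figure_eight_def coil_def)
  ultimately show ?thesis using sol Q(2) by blast
  qed
qed

end
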